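(* Let $\Omega\subset\mathbb{R}^N$ be a smoothly bounded domain, $\alpha\in(0,1)$, $s\in(0,1)$, $p\ge2$. Assume that $u_0>0$ and that one of the following conditions holds: (a) $m=q-1>0$ and $\gamma+\mu<0$; (b) $m>0$, $q>1$ and $\gamma<0$, $\mu=0$; (c) $m>0$, $q>1$ and $\gamma=0$, $\mu<0$. Then the positive global solution of the problem $$\mathcal{D}_{0|t}^{\alpha}u+(-\Delta)_p^s u=\gamma|u|^{m-1}u+\mu|u|^{q-2}u \ \ (x\in\Omega,\ t>0),\qquad u=0\ \ (x\in\mathbb{R}^N\setminus\Omega,\ t>0),\qquad u(x,0)=u_0(x)\ \ (x\in\Omega)$$ satisfies the estimate $$0<u(x,t)\le\frac{M}{1+t^{\frac{\alpha}{r}}},\qquad t\ge0,\ x\in\Omega,$$ where $M$ is a positive constant depending on $u_0$, and $r=m$ in cases (a), (b) and $r=q-1$ in cases (a), (c).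
   Context: Caputo derivative: for $\alpha\in(0,1)$ and $u\in C^1([0,T])$, $\mathcal{D}_{0|t}^{\alpha}u(t)=\frac{1}{\Gamma(1-\alpha)}\int_0^t (t-\tau)^{-\alpha}u'(\tau)\,d\tau$, which also equals $\frac{1}{\Gamma(1-\alpha)}\frac{d}{dt}\int_0^t(t-\tau)^{-\alpha}[u(\tau)-u(0)]\,d\tau$; it acts in the time variable. Fractional $p$-Laplacian: $(-\Delta)_p^s u(x)=C_{N,s,p}\,\mathrm{P.V.}\int_{\mathbb{R}^N}\frac{|u(x)-u(y)|^{p-2}(u(x)-u(y))}{|x-y|^{N+sp}}dy$ with a normalization constant $C_{N,s,p}>0$; in weak formulations the constant is omitted, as below. Spaces: $W^{s,p}(\Omega)$ is the space of $u\in L^p(\Omega)$ with $u=0$ in $\mathbb{R}^N\setminus\Omega$ and $\frac{|u(x)-u(y)|}{|x-y|^{N/p+s}}\in L^p(\mathcal{W})$, $\mathcal{W}=(\mathbb{R}^N\times\mathbb{R}^N)\setminus((\mathbb{R}^N\setminus\Omega)\times(\mathbb{R}^N\setminus\Omega))$. $W_0^{s,p}(\Omega)$ is the usual fractional Sobolev space with zero boundary values. $X(\Omega;L^\infty(0,T))$ denotes functions of $(x,t)$ that are of class $X(\Omega)$ in $x$ and $L^\infty(0,T)$ in $t$. Solutions are weak solutions on $\Omega\times(0,T)$: $u\in W^{s,p}(\Omega;L^\infty(0,T))\cap L^2(\Omega;L^\infty(0,T))$ (with $u(\cdot,0)=u_0$ and $u=0$ outside $\Omega$) such that $$\int_0^T\!\!\int_\Omega\mathcal{D}_{0|t}^{\alpha}u\,\varphi\,dxdt+\int_0^T\!\!\int_\Omega\int_\Omega\frac{|u(x)-u(y)|^{p-2}(u(x)-u(y))}{|x-y|^{N+sp}}(\varphi(x)-\varphi(y))\,dxdydt=\gamma\int_0^T\!\!\int_\Omega|u|^{m-1}u\varphi\,dxdt+\mu\int_0^T\!\!\int_\Omega|u|^{q-2}u\varphi\,dxdt$$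 (where $u(x)=u(x,t)$, $\varphi(x)=\varphi(x,t)$) for every $\varphi\in W_0^{s,p}(\Omega;L^\infty(0,T))$ with $\varphi\ge0$ in $\Omega$, $\varphi=0$ on $\partial\Omega$. A global solution is one that exists on $\Omega\times(0,T)$ for every $T>0$.
   Formalization: The initial datum u_0 is additionally assumed to be (essentially) bounded on Ω; without this the estimate fails already at t = 0, where it reads u_0 ≤ M. *)

theory Defs
  imports "HOL-Analysis.Analysis"
begin

section \<open>Smoothly bounded domains\<close>

text \<open>For an open set \<open>S\<close>, \<open>Ck_on k f S\<close> is the classical class of functions that are
  \<open>k\<close> times continuously differentiable on \<open>S\<close>.\<close>

fun Ck_on :: "nat \<Rightarrow> ('a::euclidean_space \<Rightarrow> real) \<Rightarrow> 'a set \<Rightarrow> bool" where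
  "Ck_on 0 f S \<longleftrightarrow> continuous_on S f"
| "Ck_on (Suc k) f S \<longleftrightarrow>
     (\<forall>x\<in>S. f differentiable (at x)) \<and>
     (\<forall>v. Ck_on k (\<lambda>x. frechet_derivative f (at x) v) S)"

definition smooth_fun_on :: "('a::euclidean_space \<Rightarrow> real) \<Rightarrow> 'a set \<Rightarrow> bool" where
  "smooth_fun_on f S \<longleftrightarrow> (\<forall>k. Ck_on k f S)"

text \<open>Smoothness of the boundary is expressed by local defining functions \<open>\<rho>\<close>: near each
  boundary point, the domain is \<open>{\<rho> < 0}\<close> with \<open>\<rho>\<close> of class \<open>C\<close>-infinity and nowhere
  vanishing differential.\<close>

definition smoothly_bounded_domain :: "'a::euclidean_space set \<Rightarrow> bool" where
  "smoothly_bounded_domain \<Omega> \<longleftrightarrow>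
     open \<Omega> \<and> connected \<Omega> \<and> bounded \<Omega> \<and> \<Omega> \<noteq> {} \<and>
     (\<forall>z\<in>frontier \<Omega>. \<exists>V \<rho>. open V \<and> z \<in> V \<and> smooth_fun_on \<rho> V \<and>
        (\<forall>x\<in>V. frechet_derivative \<rho> (at x) \<noteq> (\<lambda>v. 0)) \<and>
        \<Omega> \<inter> V = {x \<in> V. \<rho> x < 0})"


section \<open>Caputo derivative\<close>

definition caputo :: "real \<Rightarrow> (real \<Rightarrow> real) \<Rightarrow> real \<Rightarrow> real" where
  "caputo \<alpha> u t =
     1 / Gamma (1 - \<alpha>) * (LINT \<tau>:{0..t}|lebesgue. (t - \<tau>) powr (- \<alpha>) * deriv u \<tau>)"

text \<open>Absolute continuity on \<open>{a..b}\<close>, in the form of Lebesgue's fundamental theorem of calculus: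
  \<open>u\<close> is differentiable almost everywhere, \<open>u'\<close> is Lebesgue integrable, and \<open>u\<close> is the
  indefinite integral of \<open>u'\<close>.  It contains \<open>C\<^sup>1\<close>, and the two usual
  expressions for the Caputo derivative agree almost everywhere on it.  Demanding \<open>C\<^sup>1\<close> up to
  \<open>t = 0\<close> would be too much: it forces the Caputo derivative to vanish as \<open>t\<close> tends to \<open>0\<close>,
  whereas solutions of fractional evolution equations behave like \<open>t powr \<alpha>\<close> there.\<close>

definition abs_cont_on :: "real \<Rightarrow> real \<Rightarrow> (real \<Rightarrow> real) \<Rightarrow> bool" where
  "abs_cont_on a b u \<longleftrightarrow>
     (AE t in lebesgue. t \<in> {a..b} \<longrightarrow> u differentiable (at t)) \<and>
     set_integrable lebesgue {a..b} (deriv u) \<and>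
     (\<forall>t\<in>{a..b}. u t = u a + (LINT \<tau>:{a..t}|lebesgue. deriv u \<tau>))"


section \<open>Function spaces\<close>

text \<open>Elements of the spaces are represented by functions on the whole space; equality
  almost everywhere is not factored out.\<close>

definition Lp_on :: "real \<Rightarrow> 'a::euclidean_space set \<Rightarrow> ('a \<Rightarrow> real) set" where
  "Lp_on p \<Omega> = {f. set_borel_measurable lebesgue \<Omega> f \<and>
                  set_integrable lebesgue \<Omega> (\<lambda>x. \<bar>f x\<bar> powr p)}"

definition Lp_norm_on :: "real \<Rightarrow> 'a::euclidean_space set \<Rightarrow> ('a \<Rightarrow> real) \<Rightarrow> real" where
  "Lp_norm_on p \<Omega> f = (LINT x:\<Omega>|lebesgue. \<bar>f x\<bar> powr p) powr (1 / p)"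

definition Linf_on :: "'a::euclidean_space set \<Rightarrow> ('a \<Rightarrow> real) set" where
  "Linf_on \<Omega> = {f. set_borel_measurable lebesgue \<Omega> f \<and>
                  (\<exists>K. AE x in lebesgue. x \<in> \<Omega> \<longrightarrow> \<bar>f x\<bar> \<le> K)}"

definition gagliardo_region :: "'a::euclidean_space set \<Rightarrow> ('a \<times> 'a) set" where
  "gagliardo_region \<Omega> = UNIV - (- \<Omega>) \<times> (- \<Omega>)"

text \<open>On the diagonal the quotient is \<open>0 / 0 = 0\<close>; the diagonal is a null set.\<close>

definition gagliardo_quotient ::
  "real \<Rightarrow> real \<Rightarrow> ('a::euclidean_space \<Rightarrow> real) \<Rightarrow> 'a \<times> 'a \<Rightarrow> real" where
  "gagliardo_quotient s p u =
     (\<lambda>(x, y). \<bar>u x - u y\<bar> / norm (x - y) powr (real DIM('a) / p + s))"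

definition Wsp :: "real \<Rightarrow> real \<Rightarrow> 'a::euclidean_space set \<Rightarrow> ('a \<Rightarrow> real) set" where
  "Wsp s p \<Omega> = {u. u \<in> Lp_on p \<Omega> \<and> (\<forall>x. x \<notin> \<Omega> \<longrightarrow> u x = 0) \<and>
                  gagliardo_quotient s p u \<in> Lp_on p (gagliardo_region \<Omega>)}"

definition Wsp_norm :: "real \<Rightarrow> real \<Rightarrow> 'a::euclidean_space set \<Rightarrow> ('a \<Rightarrow> real) \<Rightarrow> real" where
  "Wsp_norm s p \<Omega> u =
     Lp_norm_on p \<Omega> u + Lp_norm_on p (gagliardo_region \<Omega>) (gagliardo_quotient s p u)"

text \<open>\<open>Wsp s p UNIV\<close> is the full fractional Sobolev space of the whole space, so the next
  definition is the space of its elements that vanish outside \<open>\<Omega>\<close>.\<close>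

definition Wsp0 :: "real \<Rightarrow> real \<Rightarrow> 'a::euclidean_space set \<Rightarrow> ('a \<Rightarrow> real) set" where
  "Wsp0 s p \<Omega> = {u \<in> Wsp s p UNIV. \<forall>x. x \<notin> \<Omega> \<longrightarrow> u x = 0}"

text \<open>Functions \<open>u x t\<close> of class \<open>X\<close> in \<open>x\<close> and essentially bounded in \<open>t \<in> (0,T)\<close>, with
  respect to the norm \<open>nrm\<close> of \<open>X\<close>.\<close>

definition Linf_time ::
  "real \<Rightarrow> ('a::euclidean_space \<Rightarrow> real) set \<Rightarrow> (('a \<Rightarrow> real) \<Rightarrow> real)
    \<Rightarrow> 'a set \<Rightarrow> ('a \<Rightarrow> real \<Rightarrow> real) set" where
  "Linf_time T X nrm \<Omega> =
     {u. set_borel_measurable lebesgue (\<Omega> \<times> {0<..<T}) (\<lambda>(x, t). u x t) \<and>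
         (\<exists>K. AE t in lebesgue. t \<in> {0<..<T} \<longrightarrow>
                (\<lambda>x. u x t) \<in> X \<and> nrm (\<lambda>x. u x t) \<le> K)}"


section \<open>Weak solutions\<close>

definition test_functions ::
  "real \<Rightarrow> real \<Rightarrow> 'a::euclidean_space set \<Rightarrow> real \<Rightarrow> ('a \<Rightarrow> real \<Rightarrow> real) set" where
  "test_functions s p \<Omega> T =
     {\<phi> \<in> Linf_time T (Wsp0 s p \<Omega>) (Wsp_norm s p UNIV) \<Omega>.
        (\<forall>t\<in>{0<..<T}. (\<forall>x\<in>\<Omega>. 0 \<le> \<phi> x t) \<and> (\<forall>x\<in>frontier \<Omega>. \<phi> x t = 0))}"

definition time_integrand ::
  "real \<Rightarrow> ('a \<Rightarrow> real \<Rightarrow> real) \<Rightarrow> ('a \<Rightarrow> real \<Rightarrow> real) \<Rightarrow> 'a \<times> real \<Rightarrow> real" where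
  "time_integrand \<alpha> u \<phi> = (\<lambda>(x, t). caputo \<alpha> (u x) t * \<phi> x t)"

definition space_integrand ::
  "real \<Rightarrow> real \<Rightarrow> ('a::euclidean_space \<Rightarrow> real \<Rightarrow> real) \<Rightarrow> ('a \<Rightarrow> real \<Rightarrow> real)
    \<Rightarrow> 'a \<times> 'a \<times> real \<Rightarrow> real" where
  "space_integrand s p u \<phi> = (\<lambda>(x, y, t).
     \<bar>u x t - u y t\<bar> powr (p - 2) * (u x t - u y t)
       / norm (x - y) powr (real DIM('a) + s * p) * (\<phi> x t - \<phi> y t))"

definition power_integrand ::
  "real \<Rightarrow> real \<Rightarrow> ('a \<Rightarrow> real \<Rightarrow> real) \<Rightarrow> ('a \<Rightarrow> real \<Rightarrow> real) \<Rightarrow> 'a \<times> real \<Rightarrow> real" where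
  "power_integrand c k u \<phi> = (\<lambda>(x, t). c * (\<bar>u x t\<bar> powr k * u x t * \<phi> x t))"

text \<open>The integrability clauses make the weak identity meaningful, since the Bochner integral
  of a non-integrable function is \<open>0\<close> by convention.  A coefficient that is \<open>0\<close> imposes no
  integrability condition.\<close>

definition weak_identity ::
  "real \<Rightarrow> real \<Rightarrow> real \<Rightarrow> real \<Rightarrow> real \<Rightarrow> real \<Rightarrow> real \<Rightarrow> 'a::euclidean_space set \<Rightarrow> real
    \<Rightarrow> ('a \<Rightarrow> real \<Rightarrow> real) \<Rightarrow> ('a \<Rightarrow> real \<Rightarrow> real) \<Rightarrow> bool" where
  "weak_identity \<alpha> s p \<gamma> \<mu> m q \<Omega> T u \<phi> \<longleftrightarrow>
     set_integrable lebesgue (\<Omega> \<times> {0<..<T}) (time_integrand \<alpha> u \<phi>) \<and>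
     set_integrable lebesgue (\<Omega> \<times> \<Omega> \<times> {0<..<T}) (space_integrand s p u \<phi>) \<and>
     set_integrable lebesgue (\<Omega> \<times> {0<..<T}) (power_integrand \<gamma> (m - 1) u \<phi>) \<and>
     set_integrable lebesgue (\<Omega> \<times> {0<..<T}) (power_integrand \<mu> (q - 2) u \<phi>) \<and>
     (LINT z:\<Omega> \<times> {0<..<T}|lebesgue. time_integrand \<alpha> u \<phi> z)
       + (LINT z:\<Omega> \<times> \<Omega> \<times> {0<..<T}|lebesgue. space_integrand s p u \<phi> z)
     = (LINT z:\<Omega> \<times> {0<..<T}|lebesgue. power_integrand \<gamma> (m - 1) u \<phi> z)
       + (LINT z:\<Omega> \<times> {0<..<T}|lebesgue. power_integrand \<mu> (q - 2) u \<phi> z)"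

definition weak_solution ::
  "real \<Rightarrow> real \<Rightarrow> real \<Rightarrow> real \<Rightarrow> real \<Rightarrow> real \<Rightarrow> real \<Rightarrow> 'a::euclidean_space set
    \<Rightarrow> ('a \<Rightarrow> real) \<Rightarrow> real \<Rightarrow> ('a \<Rightarrow> real \<Rightarrow> real) \<Rightarrow> bool" where
  "weak_solution \<alpha> s p \<gamma> \<mu> m q \<Omega> u0 T u \<longleftrightarrow>
     u \<in> Linf_time T (Wsp s p \<Omega>) (Wsp_norm s p \<Omega>) \<Omega> \<and>
     u \<in> Linf_time T (Lp_on 2 \<Omega>) (Lp_norm_on 2 \<Omega>) \<Omega> \<and>
     (AE x in lebesgue. x \<in> \<Omega> \<longrightarrow> abs_cont_on 0 T (u x)) \<and>
     (AE x in lebesgue. x \<in> \<Omega> \<longrightarrow> u x 0 = u0 x) \<and>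
     (\<forall>x. x \<notin> \<Omega> \<longrightarrow> (\<forall>t\<in>{0<..<T}. u x t = 0)) \<and>
     (\<forall>\<phi>\<in>test_functions s p \<Omega> T. weak_identity \<alpha> s p \<gamma> \<mu> m q \<Omega> T u \<phi>)"

definition global_solution ::
  "real \<Rightarrow> real \<Rightarrow> real \<Rightarrow> real \<Rightarrow> real \<Rightarrow> real \<Rightarrow> real \<Rightarrow> 'a::euclidean_space set
    \<Rightarrow> ('a \<Rightarrow> real) \<Rightarrow> ('a \<Rightarrow> real \<Rightarrow> real) \<Rightarrow> bool" where
  "global_solution \<alpha> s p \<gamma> \<mu> m q \<Omega> u0 u \<longleftrightarrow>
     (\<forall>T>0. weak_solution \<alpha> s p \<gamma> \<mu> m q \<Omega> u0 T u)"

definition positive_global_solution ::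
  "real \<Rightarrow> real \<Rightarrow> real \<Rightarrow> real \<Rightarrow> real \<Rightarrow> real \<Rightarrow> real \<Rightarrow> 'a::euclidean_space set
    \<Rightarrow> ('a \<Rightarrow> real) \<Rightarrow> ('a \<Rightarrow> real \<Rightarrow> real) \<Rightarrow> bool" where
  "positive_global_solution \<alpha> s p \<gamma> \<mu> m q \<Omega> u0 u \<longleftrightarrow>
     global_solution \<alpha> s p \<gamma> \<mu> m q \<Omega> u0 u \<and>
     (AE x in lebesgue. x \<in> \<Omega> \<longrightarrow> (\<forall>t>0. 0 < u x t))"

end

theory Submission
  imports Defs
begin

text \<open>
  Compare the solution with the barrier \<open>w t = B * (L + t) powr (- \<alpha> / r)\<close>.  Its Caputo
  derivative is bounded below by a negative multiple of \<open>(L + t) powr (- \<alpha>)\<close>, and this is also the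
  order of \<open>w powr r\<close>, so \<open>w\<close> is a supersolution of the spatially homogeneous equation with
  absorption \<open>c * w powr r\<close> as soon as \<open>L\<close> is large, while \<open>w 0\<close> dominates \<open>u0\<close>.
  Testing the weak identity with the positive part of \<open>u - w\<close>, the nonlocal term is nonnegative
  pointwise by monotonicity.  The memory term is nonnegative along each trajectory because the
  kernel \<open>\<sigma> powr (- \<alpha>)\<close> is a positive mixture of indicators of intervals \<open>[0, h]\<close>, and for
  each of these it reduces to comparing \<open>v t\<close> with \<open>v (t - h)\<close>, where \<open>v\<close> is the difference of
  the trajectory and the barrier.  What remains is the strictly monotone absorption term, which
  forces the positive part of \<open>u - w\<close> to vanish.
\<close>

section \<open>Lebesgue measure on products\<close>

text \<open>The definitions integrate over \<open>lebesgue\<close>, while Fubini and affine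
  substitution are carried out over \<open>lborel\<close>. A Borel representative \<open>g\<close>
  links the two: completeness of \<open>lebesgue\<close> makes \<open>f\<close> measurable, and a
  null set changes neither integrability nor the integral.\<close>

lemma lebesgue_lborel_cong_AE:
  fixes f g :: "'a::euclidean_space \<Rightarrow> real"
  assumes g: "g \<in> borel_measurable borel" and e: "AE x in lborel. f x = g x"
  shows "integrable lebesgue f \<longleftrightarrow> integrable lborel g"
    and "integral\<^sup>L lebesgue f = integral\<^sup>L lborel g"
proof -
  have gm: "g \<in> borel_measurable lborel" using g by simp
  have m: "g \<in> borel_measurable lebesgue" by (rule measurable_completion[OF gm])
  have e': "AE x in lebesgue. f x = g x" using e by (rule AE_completion)
  hence "AE x in lebesgue. g x = f x" by eventually_elim simp
  from borel_measurable_AE[OF m this] have f: "f \<in> borel_measurable lebesgue" .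
  show "integrable lebesgue f \<longleftrightarrow> integrable lborel g"
    using integrable_cong_AE[OF f m e'] integrable_completion[OF gm] by simp
  show "integral\<^sup>L lebesgue f = integral\<^sup>L lborel g"
    using integral_cong_AE[OF f m e'] integral_completion[OF gm] by simp
qed

lemma integrable_lebesgue_borel_ae:
  fixes f :: "'a::euclidean_space \<Rightarrow> real"
  assumes "integrable lebesgue f"
  obtains g where "integrable lborel g" "AE x in lborel. f x = g x"
    "integral\<^sup>L lebesgue f = integral\<^sup>L lborel g"
proof -
  from assms have f: "f \<in> borel_measurable (completion lborel)" by auto
  from completion_ex_borel_measurable_real[OF f] obtain g where
    g: "g \<in> borel_measurable borel" "AE x in lborel. f x = g x" by auto
  show thesis
    by (rule that[of g]) (use assms g lebesgue_lborel_cong_AE[OF g] in auto)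
qed

lemma pair_sigma_finite_lborel:
  "pair_sigma_finite (lborel::'a::euclidean_space measure) (lborel::'b::euclidean_space measure)" ..

lemma AE_lborel_pair:
  assumes "AE z in (lborel::('a::euclidean_space \<times> 'b::euclidean_space) measure). P z"
  shows "AE x in lborel. AE y in lborel. P (x, y)"
  by (rule pair_sigma_finite.AE_pair[OF pair_sigma_finite_lborel, unfolded lborel_prod, OF assms])

text \<open>On the product space \<open>lebesgue\<close> is the completion of the product, not the
  product of two completions. Hence \<open>f\<close> is first replaced by a Borel representative;
  for almost every \<open>x\<close> the sections of the two functions agree almost
  everywhere.\<close>

lemma lebesgue_Fubini:
  fixes f :: "'a::euclidean_space \<times> 'b::euclidean_space \<Rightarrow> real"
  assumes "integrable lebesgue f"
  shows "AE x in lebesgue. integrable lebesgue (\<lambda>y. f (x, y))"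
    and "integrable lebesgue (\<lambda>x. LINT y|lebesgue. f (x, y))"
    and "(LINT x|lebesgue. LINT y|lebesgue. f (x, y)) = integral\<^sup>L lebesgue f"
proof -
  note P = pair_sigma_finite_lborel[where 'a='a and 'b='b]
  obtain g where g: "integrable lborel g" "AE x in lborel. f x = g x"
    "integral\<^sup>L lebesgue f = integral\<^sup>L lborel g"
    using integrable_lebesgue_borel_ae[OF assms] .
  have gp: "integrable (lborel \<Otimes>\<^sub>M lborel) g" using g(1) by (simp add: lborel_prod)
  have ae: "AE x in lborel. AE y in lborel. f (x, y) = g (x, y)" by (rule AE_lborel_pair[OF g(2)])
  have gb: "g \<in> borel_measurable (borel \<Otimes>\<^sub>M borel)" using g(1) by (simp add: borel_prod)
  have gx: "(\<lambda>y. g (x, y)) \<in> borel_measurable borel" for x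
    by (rule measurable_compose[OF _ gb]) simp
  have both: "AE x in lborel. integrable lebesgue (\<lambda>y. f (x, y)) \<and>
      (LINT y|lebesgue. f (x, y)) = (LINT y|lborel. g (x, y))"
    using ae pair_sigma_finite.AE_integrable_fst'[OF P gp]
    by eventually_elim (simp add: lebesgue_lborel_cong_AE[OF gx])
  show "AE x in lebesgue. integrable lebesgue (\<lambda>y. f (x, y))"
    by (rule AE_completion) (use both in eventually_elim, simp)
  have I: "integrable lborel (\<lambda>x. LINT y|lborel. g (x, y))"
    by (rule pair_sigma_finite.integrable_fst'[OF P gp])
  have e: "AE x in lborel. (LINT y|lebesgue. f (x, y)) = (LINT y|lborel. g (x, y))"
    using both by eventually_elim simp
  have Ib: "(\<lambda>x. LINT y|lborel. g (x, y)) \<in> borel_measurable borel" using I by auto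
  show "integrable lebesgue (\<lambda>x. LINT y|lebesgue. f (x, y))"
    using lebesgue_lborel_cong_AE(1)[OF Ib e] I by simp
  show "(LINT x|lebesgue. LINT y|lebesgue. f (x, y)) = integral\<^sup>L lebesgue f"
    using lebesgue_lborel_cong_AE(2)[OF Ib e] g(3) pair_sigma_finite.integral_fst'[OF P gp]
    by (simp add: lborel_prod)
qed

text \<open>Borel measurability of a projection does not suffice when \<open>f\<close> is only
  Lebesgue measurable. The preimage of a null set is a cylinder over it, again null, so projections
  are measurable between the completed spaces.\<close>

lemma borel_measurable_lebesgue_fst_snd:
  fixes f :: "'a::euclidean_space \<Rightarrow> real"
  assumes "f \<in> borel_measurable lebesgue"
  shows "(\<lambda>z::'a \<times> 'b::euclidean_space. f (fst z)) \<in> borel_measurable lebesgue"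
    and "(\<lambda>z::'b \<times> 'a. f (snd z)) \<in> borel_measurable lebesgue"
proof -
  have "N \<times> (UNIV::'b set) \<in> null_sets lborel" "(UNIV::'b set) \<times> N \<in> null_sets lborel"
    if "N \<in> null_sets lborel" for N :: "'a set"
    using that lborel.emeasure_pair_measure_Times[of N lborel "UNIV::'b set"]
      lborel.emeasure_pair_measure_Times[of "UNIV::'b set" lborel N]
    by (auto intro!: borel_Times simp: lborel_prod null_sets_def)
  note this[THEN null_sets_completionI]
  moreover have "fst -` N = N \<times> (UNIV::'b set)" "snd -` N = (UNIV::'b set) \<times> N" for N :: "'a set"
    by auto
  moreover have f: "(fst :: 'a \<times> 'b \<Rightarrow> 'a) \<in> lebesgue \<rightarrow>\<^sub>M lborel"
    and g: "(snd :: 'b \<times> 'a \<Rightarrow> 'a) \<in> lebesgue \<rightarrow>\<^sub>M lborel"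
    by (auto intro!: measurable_completion simp: borel_prod[symmetric])
  ultimately have "emeasure (distr (lebesgue::('a \<times> 'b) measure) lborel fst) N = 0"
    "emeasure (distr (lebesgue::('b \<times> 'a) measure) lborel snd) N = 0" if "N \<in> null_sets lborel" for N
    using that by (auto simp: emeasure_distr[OF f] emeasure_distr[OF g] null_sets_def
        simp del: emeasure_completion)
  hence "(fst :: 'a \<times> 'b \<Rightarrow> 'a) \<in> lebesgue \<rightarrow>\<^sub>M lebesgue"
    "(snd :: 'b \<times> 'a \<Rightarrow> 'a) \<in> lebesgue \<rightarrow>\<^sub>M lebesgue"
    using f g by (auto intro!: completion.measurable_completion2 null_setsI)
  from this[THEN measurable_compose, OF assms]
  show "(\<lambda>z::'a \<times> 'b::euclidean_space. f (fst z)) \<in> borel_measurable lebesgue"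
    "(\<lambda>z::'b \<times> 'a. f (snd z)) \<in> borel_measurable lebesgue" by auto
qed

section \<open>Positivity of the fractional energy\<close>

text \<open>The weight is the exact derivative of \<open>- (h powr (- \<alpha>))\<close>, which
  tends to zero at infinity. Read in \<open>\<sigma>\<close>, this writes the singular kernel as a
  superposition of step functions with positive weights.\<close>

lemma has_bochner_integral_powr_tail:
  fixes \<alpha> \<sigma> :: real
  assumes "0 < \<alpha>" "0 < \<sigma>"
  shows "has_bochner_integral lborel (\<lambda>h. indicator {\<sigma>..} h * (\<alpha> * h powr (- \<alpha> - 1))) (\<sigma> powr (- \<alpha>))"
proof -
  have "(\<integral>\<^sup>+h. ennreal (\<alpha> * h powr (- \<alpha> - 1)) * indicator {\<sigma>..} h \<partial>lborel)
      = ennreal (0 - (- (\<sigma> powr (- \<alpha>))))"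
  proof (rule nn_integral_FTC_atLeast[where F="\<lambda>h. - (h powr (- \<alpha>))"])
    show "((\<lambda>h. - (h powr (- \<alpha>))) has_real_derivative \<alpha> * x powr (- \<alpha> - 1)) (at x)"
      if "\<sigma> \<le> x" for x
      using that assms by (auto intro!: derivative_eq_intros)
    have "((\<lambda>h. h powr (- \<alpha>)) \<longlongrightarrow> 0) at_top"
      using assms by (intro tendsto_neg_powr filterlim_ident) auto
    from tendsto_minus[OF this] show "((\<lambda>h. - (h powr (- \<alpha>))) \<longlongrightarrow> 0) at_top" by simp
  qed (use assms in auto)
  hence *: "(\<integral>\<^sup>+h. ennreal (indicator {\<sigma>..} h * (\<alpha> * h powr (- \<alpha> - 1))) \<partial>lborel)
      = ennreal (\<sigma> powr (- \<alpha>))"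
    by (subst (asm) nn_integral_cong[where v="\<lambda>h. ennreal (indicator {\<sigma>..} h * (\<alpha> * h powr (- \<alpha> - 1)))"])
      (auto split: split_indicator)
  show ?thesis
    by (rule has_bochner_integral_nn_integral[OF _ _ _ *]) (use assms in auto)
qed

lemma integrable_powr_kernel:
  fixes \<alpha> T :: real
  assumes "\<alpha> < 1" "0 \<le> T"
  shows "integrable lborel (\<lambda>\<sigma>. indicator {0<..T} \<sigma> * \<sigma> powr (- \<alpha>))"
proof -
  have "(\<lambda>x. x powr (- \<alpha>)) integrable_on {0<..T}"
    by (rule integrable_on_powr_from_0') (use assms in auto)
  hence "(\<lambda>x. x powr (- \<alpha>)) absolutely_integrable_on {0<..T}"
    by (intro nonnegative_absolutely_integrable_1) auto
  thus ?thesis by (simp add: set_integrable_def integrable_completion)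
qed

text \<open>Tonelli, integrating in \<open>t\<close> first: translating \<open>k\<close> does not
  change its norm, so the inner integral of the absolute value is a constant times
  \<open>\<bar>g \<tau>\<bar>\<close>.\<close>

lemma integrable_convolution_pair:
  fixes k g :: "real \<Rightarrow> real"
  assumes k: "integrable lborel k" and g: "integrable lborel g"
  shows "integrable (lborel \<Otimes>\<^sub>M lborel) (\<lambda>z. k (fst z - snd z) * g (snd z))"
proof -
  have [measurable]: "k \<in> borel_measurable borel" "g \<in> borel_measurable borel" using k g by auto
  have k': "integrable lborel (\<lambda>t. k (t - \<tau>))" for \<tau>
    using lborel_integrable_real_affine[OF k, of 1 "- \<tau>"] by simp
  have n: "(LINT t|lborel. norm (k (t - \<tau>) * g \<tau>)) = (LINT t|lborel. \<bar>k t\<bar>) * \<bar>g \<tau>\<bar>" for \<tau>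
    using lborel_integral_real_affine[of 1 "\<lambda>t. \<bar>k t\<bar>" "- \<tau>"] by (simp add: abs_mult)
  have "integrable (lborel \<Otimes>\<^sub>M lborel) (\<lambda>(\<tau>, t). k (t - \<tau>) * g \<tau>)"
    by (rule lborel_pair.Fubini_integrable) (use g k' n in auto)
  from lborel_pair.integrable_product_swap[OF this] show ?thesis
    by (simp add: case_prod_beta')
qed

text \<open>The convexity inequality \<open>a\<^sub>+ (a - b) \<ge> (a\<^sub>+\<^sup>2 - b\<^sub>+\<^sup>2) / 2\<close> makes the integral telescope.\<close>

lemma shift_energy_nonneg:
  fixes v :: "real \<Rightarrow> real"
  assumes cont: "\<And>a b. continuous_on {a..b} v" and v0: "\<And>t. t \<le> 0 \<Longrightarrow> v t \<le> 0" and "0 \<le> h" "0 \<le> T"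
  shows "0 \<le> (LINT t|lborel. indicator {0..T} t * max 0 (v t) * (v t - v (t - h)))"
proof -
  define \<psi> where "\<psi> t = (max 0 (v t))\<^sup>2 / 2" for t
  have c\<psi>: "continuous_on {a..b} \<psi>" for a b
    unfolding \<psi>_def by (intro continuous_intros cont) auto
  have cs: "continuous_on {a..b} (\<lambda>t. v (t - h))" for a b
    by (rule continuous_on_compose2[OF cont[of "a - h" "b - h"]]) (auto intro!: continuous_intros)
  have c\<psi>s: "continuous_on {a..b} (\<lambda>t. \<psi> (t - h))" for a b
    by (rule continuous_on_compose2[OF c\<psi>[of "a - h" "b - h"]]) (auto intro!: continuous_intros)
  have I: "integrable lborel (\<lambda>t. indicator {a..b} t * f t)" if "continuous_on {a..b} f"
    for a b :: real and f :: "real \<Rightarrow> real"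
    using borel_integrable_atLeastAtMost'[OF that] by (simp add: set_integrable_def)
  have "(LINT t|lborel. indicator {0..T} t * \<psi> (t - h)) = (LINT t|lborel. indicator {0..T} (t + h) * \<psi> t)"
    using lborel_integral_real_affine[of 1 "\<lambda>t. indicator {0..T} (t + h) * \<psi> t" "- h"] by simp
  \<comment> \<open>After the shift the domain is \<open>{- h..T - h}\<close>; \<open>\<psi>\<close>
    vanishes at nonpositive times, and the remaining part lies in \<open>{0..T}\<close>.\<close>
  also have "\<dots> \<le> (LINT t|lborel. indicator {0..T} t * \<psi> t)"
  proof (rule integral_mono)
    have "indicator {0..T} (t + h) = (indicator {- h..T - h} t :: real)" for t
      by (auto split: split_indicator)
    thus "integrable lborel (\<lambda>t. indicator {0..T} (t + h) * \<psi> t)" using I[OF c\<psi>[of "- h" "T - h"]] by simp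
    show "integrable lborel (\<lambda>t. indicator {0..T} t * \<psi> t)" by (rule I[OF c\<psi>])
    show "indicator {0..T} (t + h) * \<psi> t \<le> indicator {0..T} t * \<psi> t" for t
      using v0[of t] \<open>0 \<le> h\<close> by (cases "t \<le> 0") (auto simp: \<psi>_def split: split_indicator)
  qed
  finally have "0 \<le> (LINT t|lborel. indicator {0..T} t * \<psi> t) - (LINT t|lborel. indicator {0..T} t * \<psi> (t - h))"
    by simp
  also have "\<dots> = (LINT t|lborel. indicator {0..T} t * (\<psi> t - \<psi> (t - h)))"
    using I[OF c\<psi>[of 0 T]] I[OF c\<psi>s[of 0 T]] by (simp add: right_diff_distrib)
  also have "\<dots> \<le> (LINT t|lborel. indicator {0..T} t * (max 0 (v t) * (v t - v (t - h))))"
  proof (rule integral_mono)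
    show "integrable lborel (\<lambda>t. indicator {0..T} t * (\<psi> t - \<psi> (t - h)))"
      by (intro I continuous_intros c\<psi> c\<psi>s)
    show "integrable lborel (\<lambda>t. indicator {0..T} t * (max 0 (v t) * (v t - v (t - h))))"
      by (intro I continuous_intros cont cs)
    have "(max 0 a)\<^sup>2 / 2 - (max 0 b)\<^sup>2 / 2 \<le> max 0 a * (a - b)" for a b :: real
    proof -
      have "(max 0 a)\<^sup>2 / 2 - (max 0 b)\<^sup>2 / 2 \<le> max 0 a * (max 0 a - max 0 b)"
        using zero_le_power2[of "max 0 a - max 0 b"] by (simp add: power2_eq_square field_simps)
      also have "\<dots> \<le> max 0 a * (a - b)"
        by (cases "a \<le> 0") (auto simp: max_def intro!: mult_left_mono)
      finally show ?thesis .
    qed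
    thus "indicator {0..T} t * (\<psi> t - \<psi> (t - h)) \<le> indicator {0..T} t * (max 0 (v t) * (v t - v (t - h)))" for t
      unfolding \<psi>_def by (intro mult_left_mono) auto
  qed
  finally show ?thesis by (simp add: mult.assoc)
qed

text \<open>Dominated convergence with majorant \<open>\<bar>g \<tau>\<bar>\<close>: along a
  sequence tending to \<open>a\<close> the indicators converge at every point except possibly
  \<open>a\<close>, a null set.\<close>

lemma continuous_on_primitive:
  fixes g :: "real \<Rightarrow> real"
  assumes g: "integrable lborel g"
  shows "continuous_on UNIV (\<lambda>t. LINT \<tau>|lborel. indicator {..t} \<tau> * g \<tau>)"
proof -
  have [measurable]: "g \<in> borel_measurable borel" using g by auto
  have "isCont (\<lambda>t. LINT \<tau>|lborel. indicator {..t} \<tau> * g \<tau>) a" for a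
    unfolding continuous_at_sequentially o_def
  proof safe
    fix x assume x: "x \<longlonglongrightarrow> a"
    show "(\<lambda>n. LINT \<tau>|lborel. indicator {..x n} \<tau> * g \<tau>) \<longlonglongrightarrow> (LINT \<tau>|lborel. indicator {..a} \<tau> * g \<tau>)"
    proof (rule integral_dominated_convergence[where w="\<lambda>\<tau>. \<bar>g \<tau>\<bar>"])
      show "AE \<tau> in lborel. (\<lambda>n. indicator {..x n} \<tau> * g \<tau>) \<longlonglongrightarrow> indicator {..a} \<tau> * g \<tau>"
      proof (rule AE_mp[OF AE_lborel_singleton[of a]], rule AE_I2, rule impI)
        fix \<tau> assume "\<tau> \<noteq> a"
        have "eventually (\<lambda>n. (indicator {..x n} \<tau> :: real) = indicator {..a} \<tau>) sequentially"
        proof (cases "\<tau> < a")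
          case True
          from order_tendstoD(1)[OF x True] show ?thesis
            by eventually_elim (use True in \<open>auto split: split_indicator\<close>)
        next
          case False
          with \<open>\<tau> \<noteq> a\<close> have "a < \<tau>" by auto
          from order_tendstoD(2)[OF x this] show ?thesis
            by eventually_elim (use \<open>a < \<tau>\<close> in \<open>auto split: split_indicator\<close>)
        qed
        thus "(\<lambda>n. indicator {..x n} \<tau> * g \<tau>) \<longlonglongrightarrow> indicator {..a} \<tau> * g \<tau>"
          by (intro tendsto_mult tendsto_const tendsto_eventually)
      qed
    qed (use g in \<open>auto split: split_indicator\<close>)
  qed
  thus ?thesis by (simp add: continuous_on_eq_continuous_at)
qed

text \<open>Extending \<open>g\<close> by zero and cutting the kernel off at \<open>T\<close> turns
  the memory term into a convolution on the whole line. Then \<open>v\<close> stays at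
  \<open>v0\<close> for negative times, so \<open>v0 \<le> 0\<close> supplies the sign condition of
  \<open>shift_energy_nonneg\<close>.\<close>

lemma fractional_energy_nonneg:
  fixes g :: "real \<Rightarrow> real" and \<alpha> T v0 :: real
  assumes \<alpha>: "0 < \<alpha>" "\<alpha> < 1" and T: "0 < T" and v0: "v0 \<le> 0"
    and g: "integrable lborel g" and g0: "\<forall>\<tau>. \<tau> \<notin> {0..T} \<longrightarrow> g \<tau> = 0"
  defines "v \<equiv> \<lambda>t. v0 + (LINT \<tau>|lborel. indicator {..t} \<tau> * g \<tau>)"
    and "k \<equiv> \<lambda>\<sigma>. indicator {0<..T} \<sigma> * \<sigma> powr (- \<alpha>)"
  shows "AE t in lborel. integrable lborel (\<lambda>\<tau>. k (t - \<tau>) * g \<tau>)"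
    and "integrable lborel (\<lambda>t. indicator {0..T} t * max 0 (v t) * (LINT \<tau>|lborel. k (t - \<tau>) * g \<tau>))"
    and "0 \<le> (LINT t|lborel. indicator {0..T} t * max 0 (v t) * (LINT \<tau>|lborel. k (t - \<tau>) * g \<tau>))"
proof -
  have [measurable]: "g \<in> borel_measurable borel" using g by auto
  have k: "integrable lborel k" unfolding k_def by (rule integrable_powr_kernel) (use \<alpha> T in auto)
  have [measurable]: "k \<in> borel_measurable borel" using k by auto
  have cv: "continuous_on UNIV v"
    unfolding v_def by (intro continuous_intros continuous_on_primitive g)
  have cv': "continuous_on {a..b} v" for a b by (rule continuous_on_subset[OF cv]) auto
  have [measurable]: "v \<in> borel_measurable borel" by (rule borel_measurable_continuous_onI[OF cv])
  have vneg: "v t \<le> 0" if "t \<le> 0" for t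
  proof -
    \<comment> \<open>For \<open>t = 0\<close> the integrand may be nonzero at the single point
      \<open>0\<close>, so the equality holds only almost everywhere.\<close>
    have "(LINT \<tau>|lborel. indicator {..t} \<tau> * g \<tau>) = (LINT \<tau>|(lborel::real measure). 0)"
      by (rule integral_cong_AE, measurable, rule AE_mp[OF AE_lborel_singleton[of 0]])
        (use that g0 in \<open>auto split: split_indicator intro!: AE_I2\<close>)
    thus ?thesis using v0 by (simp add: v_def)
  qed
  \<comment> \<open>The test factor is bounded because \<open>v\<close> is continuous on a compact
    interval; multiplying by it preserves the integrability of the convolution.\<close>
  define G where "G t = indicator {0..T} t * max 0 (v t)" for t
  have [measurable]: "G \<in> borel_measurable borel" unfolding G_def by measurable
  have "bounded (v ` {0..T})" by (intro compact_imp_bounded compact_continuous_image cv') auto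
  then obtain C where C: "\<And>t. t \<in> {0..T} \<Longrightarrow> \<bar>v t\<bar> \<le> C"
    unfolding bounded_iff by (metis image_eqI real_norm_def)
  have GC: "\<bar>G t\<bar> \<le> \<bar>C\<bar>" for t
    using C[of t] by (auto simp: G_def max_def abs_le_iff split: split_indicator)
  have pint: "integrable (lborel \<Otimes>\<^sub>M lborel) (\<lambda>z. G (fst z) * (l (fst z - snd z) * g (snd z)))"
    if l: "integrable lborel l" for l
  proof (rule Bochner_Integration.integrable_bound)
    show "integrable (lborel \<Otimes>\<^sub>M lborel) (\<lambda>z. \<bar>C\<bar> * (l (fst z - snd z) * g (snd z)))"
      by (intro integrable_mult_right integrable_convolution_pair l g)
    have [measurable]: "l \<in> borel_measurable borel" using l by auto
    show "(\<lambda>z. G (fst z) * (l (fst z - snd z) * g (snd z))) \<in> borel_measurable (lborel \<Otimes>\<^sub>M lborel)"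
      by measurable
    show "AE z in lborel \<Otimes>\<^sub>M lborel. norm (G (fst z) * (l (fst z - snd z) * g (snd z)))
        \<le> norm (\<bar>C\<bar> * (l (fst z - snd z) * g (snd z)))"
      by (intro AE_I2) (use GC in \<open>auto simp: abs_mult intro!: mult_right_mono\<close>)
  qed
  show "AE t in lborel. integrable lborel (\<lambda>\<tau>. k (t - \<tau>) * g \<tau>)"
    using lborel_pair.AE_integrable_fst'[OF integrable_convolution_pair[OF k g]] by simp
  show "integrable lborel (\<lambda>t. indicator {0..T} t * max 0 (v t) * (LINT \<tau>|lborel. k (t - \<tau>) * g \<tau>))"
    using lborel_pair.integrable_fst'[OF pint[OF k]] by (simp add: G_def)
  \<comment> \<open>The kernel is a positive mixture of indicators of intervals:
    \<open>\<sigma> powr (- \<alpha>)\<close> is the integral of \<open>\<alpha> * h powr (- \<alpha> - 1)\<close> over \<open>h \<ge> \<sigma>\<close>.\<close>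
  define F where "F z h = G (fst z) * (indicator {0<..T} (fst z - snd z) * g (snd z))
      * (indicator {fst z - snd z..} h * (\<alpha> * h powr (- \<alpha> - 1)))" for z :: "real \<times> real" and h :: real
  interpret S: sigma_finite_measure "lborel \<Otimes>\<^sub>M lborel :: (real \<times> real) measure"
    by (simp add: lborel_prod) standard
  interpret Q: pair_sigma_finite "lborel \<Otimes>\<^sub>M lborel :: (real \<times> real) measure" "lborel :: real measure" ..
  have Fh: "has_bochner_integral lborel (F z) (G (fst z) * (k (fst z - snd z) * g (snd z)))" for z
  proof (cases "fst z - snd z \<in> {0<..T}")
    case True
    hence "0 < fst z - snd z" by simp
    from has_bochner_integral_mult_right[OF has_bochner_integral_powr_tail[OF \<alpha>(1) this],
        of "G (fst z) * g (snd z)"] True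
    show ?thesis by (simp add: F_def[abs_def] k_def mult_ac)
  next
    case False
    thus ?thesis by (simp add: F_def[abs_def] k_def has_bochner_integral_zero)
  qed
  \<comment> \<open>Since \<open>g\<close> may change sign, interchanging the integrals needs
    absolute integrability. The weights in \<open>h\<close> are nonnegative, so the absolute value
    falls on the coefficient alone.\<close>
  have Fabs: "has_bochner_integral lborel (\<lambda>h. \<bar>F z h\<bar>) \<bar>G (fst z) * (k (fst z - snd z) * g (snd z))\<bar>" for z
  proof (cases "fst z - snd z \<in> {0<..T}")
    case True
    hence "0 < fst z - snd z" by simp
    from has_bochner_integral_mult_right[OF has_bochner_integral_powr_tail[OF \<alpha>(1) this],
        of "\<bar>G (fst z) * g (snd z)\<bar>"] True \<alpha>
    show ?thesis by (simp add: F_def[abs_def] k_def mult_ac abs_mult)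
  next
    case False
    thus ?thesis by (simp add: F_def[abs_def] k_def has_bochner_integral_zero)
  qed
  have [measurable]: "(\<lambda>w::(real\<times>real)\<times>real. indicator {fst (fst w) - snd (fst w)..} (snd w) :: real)
      \<in> borel_measurable ((lborel \<Otimes>\<^sub>M lborel) \<Otimes>\<^sub>M lborel)"
  proof -
    have e: "(\<lambda>w. indicator {fst (fst w) - snd (fst w)..} (snd w) :: real)
      = (\<lambda>w::(real\<times>real)\<times>real. if fst (fst w) - snd (fst w) \<le> snd w then 1 else 0)"
      by (auto split: split_indicator)
    show ?thesis unfolding e by measurable
  qed
  have Fint: "integrable ((lborel \<Otimes>\<^sub>M lborel) \<Otimes>\<^sub>M lborel) (\<lambda>(z, h). F z h)"
  proof (rule Q.Fubini_integrable)
    show "(\<lambda>(z, h). F z h) \<in> borel_measurable ((lborel \<Otimes>\<^sub>M lborel) \<Otimes>\<^sub>M lborel)"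
      unfolding F_def case_prod_beta by measurable
    show "integrable (lborel \<Otimes>\<^sub>M lborel) (\<lambda>z. LINT h|lborel. norm (case (z, h) of (z, h) \<Rightarrow> F z h))"
      using has_bochner_integral_integral_eq[OF Fabs] integrable_abs[OF pint[OF k]] by simp
    show "AE z in lborel \<Otimes>\<^sub>M lborel. integrable lborel (\<lambda>h. case (z, h) of (z, h) \<Rightarrow> F z h)"
      using Fh by (auto simp: has_bochner_integral_iff)
  qed
  have slice: "0 \<le> (LINT z|(lborel \<Otimes>\<^sub>M lborel). F z h)" for h
  proof (cases "0 < h")
    case False
    hence "F z h = 0" for z by (auto simp: F_def split: split_indicator)
    thus ?thesis by simp
  next
    case True
    \<comment> \<open>The cutoff at \<open>T\<close> and the threshold \<open>h\<close> merge into
      the single interval \<open>{0<..h'}\<close>, so a slice of the mixture is a shift by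
      \<open>h'\<close>.\<close>
    define h' where "h' = min T h"
    define l where "l = (indicator {0<..h'} :: real \<Rightarrow> real)"
    have h': "0 \<le> h'" using True T by (simp add: h'_def)
    have l: "integrable lborel l" unfolding l_def
      by (rule integrable_real_indicator) (use h' in auto)
    \<comment> \<open>Convolving with the indicator integrates \<open>g\<close> from
      \<open>t - h'\<close> to \<open>t\<close>, which is an increment of its primitive; the two
      endpoints are negligible.\<close>
    have inner: "(LINT \<tau>|lborel. l (t - \<tau>) * g \<tau>) = v t - v (t - h')" for t
    proof -
      have i: "integrable lborel (\<lambda>\<tau>. indicator {..a} \<tau> * g \<tau>)" for a
        using integrable_mult_indicator[OF _ g, of "{..a}"] by simp
      have "v t - v (t - h') = (LINT \<tau>|lborel. indicator {..t} \<tau> * g \<tau> - indicator {..t - h'} \<tau> * g \<tau>)"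
        unfolding v_def using i by simp
      also have "\<dots> = (LINT \<tau>|lborel. l (t - \<tau>) * g \<tau>)"
      proof (rule integral_cong_AE)
        have [measurable]: "l \<in> borel_measurable borel" unfolding l_def by simp
        show "(\<lambda>\<tau>. l (t - \<tau>) * g \<tau>) \<in> borel_measurable lborel" by measurable
        show "AE \<tau> in lborel. indicator {..t} \<tau> * g \<tau> - indicator {..t - h'} \<tau> * g \<tau> = l (t - \<tau>) * g \<tau>"
          using AE_lborel_singleton[of t] AE_lborel_singleton[of "t - h'"]
          by eventually_elim (use h' in \<open>auto simp: l_def split: split_indicator\<close>)
      qed simp
      finally show ?thesis by simp
    qed
    have "(LINT z|(lborel \<Otimes>\<^sub>M lborel). F z h)
        = (LINT z|(lborel \<Otimes>\<^sub>M lborel). \<alpha> * h powr (- \<alpha> - 1) * (G (fst z) * (l (fst z - snd z) * g (snd z))))"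
      by (rule Bochner_Integration.integral_cong) (auto simp: F_def l_def h'_def split: split_indicator)
    also have "\<dots> = \<alpha> * h powr (- \<alpha> - 1) * (LINT z|(lborel \<Otimes>\<^sub>M lborel). G (fst z) * (l (fst z - snd z) * g (snd z)))"
      by simp
    also have "(LINT z|(lborel \<Otimes>\<^sub>M lborel). G (fst z) * (l (fst z - snd z) * g (snd z)))
        = (LINT t|lborel. LINT \<tau>|lborel. G t * (l (t - \<tau>) * g \<tau>))"
      using lborel_pair.integral_fst'[OF pint[OF l]] by simp
    also have "\<dots> = (LINT t|lborel. indicator {0..T} t * max 0 (v t) * (v t - v (t - h')))"
      by (simp add: inner G_def)
    finally show ?thesis
      using shift_energy_nonneg[of v h' T] cv' vneg h' T \<alpha> by simp
  qed
  have "(LINT t|lborel. G t * (LINT \<tau>|lborel. k (t - \<tau>) * g \<tau>))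
      = (LINT z|(lborel \<Otimes>\<^sub>M lborel). G (fst z) * (k (fst z - snd z) * g (snd z)))"
    using lborel_pair.integral_fst'[OF pint[OF k]] by simp
  also have "\<dots> = (LINT z|(lborel \<Otimes>\<^sub>M lborel). LINT h|lborel. F z h)"
    using has_bochner_integral_integral_eq[OF Fh] by simp
  also have "\<dots> = (LINT h|lborel. LINT z|(lborel \<Otimes>\<^sub>M lborel). F z h)"
    using Q.Fubini_integral[OF Fint] by simp
  also have "\<dots> \<ge> 0" by (rule Bochner_Integration.integral_nonneg) (rule slice)
  finally show "0 \<le> (LINT t|lborel. indicator {0..T} t * max 0 (v t) * (LINT \<tau>|lborel. k (t - \<tau>) * g \<tau>))"
    by (simp add: G_def)
qed

text \<open>\<open>g\<close> enters only through integrals, so it may be exchanged for a Borel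
  function vanishing outside \<open>{0..T}\<close>. This leaves \<open>v\<close> and
  \<open>J\<close> unchanged at every time in \<open>{0..T}\<close>, not just at almost every one,
  and \<open>fractional_energy_nonneg\<close> applies.\<close>

lemma caputo_energy:
  fixes g :: "real \<Rightarrow> real" and \<alpha> T v0 :: real
  assumes \<alpha>: "0 < \<alpha>" "\<alpha> < 1" and T: "0 < T" and v0: "v0 \<le> 0"
    and g: "set_integrable lebesgue {0..T} g"
    and v: "\<And>t. t \<in> {0..T} \<Longrightarrow> v t = v0 + (LINT \<tau>:{0..t}|lebesgue. g \<tau>)"
  defines "J \<equiv> \<lambda>t. LINT \<tau>:{0..t}|lebesgue. (t - \<tau>) powr (- \<alpha>) * g \<tau>"
  shows "AE t in lebesgue. t \<in> {0..T} \<longrightarrow>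
          set_integrable lebesgue {0..t} (\<lambda>\<tau>. (t - \<tau>) powr (- \<alpha>) * g \<tau>)"
    and "set_integrable lebesgue {0..T} (\<lambda>t. max 0 (v t) * J t)"
    and "0 \<le> (LINT t:{0..T}|lebesgue. max 0 (v t) * J t)"
    and "continuous_on {0..T} v"
proof -
  obtain g1 where g1: "integrable lborel g1" "AE x in lborel. indicator {0..T} x *\<^sub>R g x = g1 x"
    using integrable_lebesgue_borel_ae[OF g[unfolded set_integrable_def]] .
  define g' where "g' x = indicator {0..T} x * g1 x" for x
  have g': "integrable lborel g'"
    using integrable_mult_indicator[OF _ g1(1), of "{0..T}"] by (simp add: g'_def[abs_def])
  have [measurable]: "g' \<in> borel_measurable borel" using g' by auto
  have g0: "\<forall>\<tau>. \<tau> \<notin> {0..T} \<longrightarrow> g' \<tau> = 0" by (simp add: g'_def)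
  have gg': "AE x in lborel. x \<in> {0..T} \<longrightarrow> g x = g' x"
    using g1(2) by eventually_elim (auto simp: g'_def)
  define v' where "v' t = v0 + (LINT \<tau>|lborel. indicator {..t} \<tau> * g' \<tau>)" for t
  define k where "k = (\<lambda>\<sigma>. indicator {0<..T} \<sigma> * \<sigma> powr (- \<alpha>))"
  have [measurable]: "k \<in> borel_measurable borel" unfolding k_def by measurable
  define J' where "J' t = (LINT \<tau>|lborel. k (t - \<tau>) * g' \<tau>)" for t
  have E: "AE t in lborel. integrable lborel (\<lambda>\<tau>. k (t - \<tau>) * g' \<tau>)"
    "integrable lborel (\<lambda>t. indicator {0..T} t * max 0 (v' t) * J' t)"
    "0 \<le> (LINT t|lborel. indicator {0..T} t * max 0 (v' t) * J' t)"
    unfolding J'_def v'_def k_def by (rule fractional_energy_nonneg[OF \<alpha> T v0 g' g0])+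
  have vv': "v t = v' t" if t: "t \<in> {0..T}" for t
  proof -
    have "AE \<tau> in lborel. indicator {0..t} \<tau> *\<^sub>R g \<tau> = indicator {..t} \<tau> * g' \<tau>"
      using gg' by eventually_elim (use t in \<open>auto simp: g0 split: split_indicator\<close>)
    from lebesgue_lborel_cong_AE(2)[OF _ this] show ?thesis
      unfolding v[OF t] v'_def set_lebesgue_integral_def by simp
  qed
  \<comment> \<open>At \<open>\<tau> = t\<close> both sides vanish, because
    \<open>0 powr (- \<alpha>)\<close> is \<open>0\<close>.\<close>
  have kJ: "AE \<tau> in lborel. indicator {0..t} \<tau> *\<^sub>R ((t - \<tau>) powr (- \<alpha>) * g \<tau>) = k (t - \<tau>) * g' \<tau>"
    if t: "t \<in> {0..T}" for t
    using gg' by eventually_elim (use t in \<open>auto simp: g0 k_def split: split_indicator\<close>)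
  have JJ': "J t = J' t" if t: "t \<in> {0..T}" for t
    using lebesgue_lborel_cong_AE(2)[OF _ kJ[OF t]]
    unfolding J_def J'_def set_lebesgue_integral_def by simp
  show "AE t in lebesgue. t \<in> {0..T} \<longrightarrow>
      set_integrable lebesgue {0..t} (\<lambda>\<tau>. (t - \<tau>) powr (- \<alpha>) * g \<tau>)"
  proof (rule AE_completion, use E(1) in eventually_elim, rule impI)
    fix t assume i: "integrable lborel (\<lambda>\<tau>. k (t - \<tau>) * g' \<tau>)" and t: "t \<in> {0..T}"
    show "set_integrable lebesgue {0..t} (\<lambda>\<tau>. (t - \<tau>) powr (- \<alpha>) * g \<tau>)"
      unfolding set_integrable_def using lebesgue_lborel_cong_AE(1)[OF _ kJ[OF t]] i by simp
  qed
  have eq: "indicator {0..T} t *\<^sub>R (max 0 (v t) * J t) = indicator {0..T} t * max 0 (v' t) * J' t" for t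
    by (auto simp: vv' JJ' split: split_indicator)
  show "set_integrable lebesgue {0..T} (\<lambda>t. max 0 (v t) * J t)"
    unfolding set_integrable_def eq
    using integrable_completion[OF borel_measurable_integrable[OF E(2)]] E(2) by simp
  show "0 \<le> (LINT t:{0..T}|lebesgue. max 0 (v t) * J t)"
    unfolding set_lebesgue_integral_def eq
    using integral_completion[OF borel_measurable_integrable[OF E(2)]] E(3) by simp
  have "continuous_on {0..T} v'"
    unfolding v'_def
    by (rule continuous_on_subset[OF continuous_on_add[OF continuous_on_const continuous_on_primitive[OF g']]]) simp
  thus "continuous_on {0..T} v" using vv' continuous_on_cong by (metis (no_types, lifting))
qed

section \<open>Power barriers\<close>

text \<open>Dividing by \<open>a + b\<close> leaves two fractions with sum one, and each
  \<open>x\<close> in \<open>{0<..1}\<close> satisfies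
  \<open>x \<le> x powr \<alpha>\<close>.\<close>

lemma powr_add_le:
  fixes a b \<alpha> :: real
  assumes "0 < a" "0 < b" "0 \<le> \<alpha>" "\<alpha> \<le> 1"
  shows "(a + b) powr \<alpha> \<le> a powr \<alpha> + b powr \<alpha>"
proof -
  have *: "x powr 1 \<le> x powr \<alpha>" if "0 < x" "x \<le> 1" for x :: real
    using that assms by (intro powr_mono') auto
  have "1 = a / (a + b) + b / (a + b)" using assms by (simp flip: add_divide_distrib)
  also have "\<dots> \<le> (a / (a + b)) powr \<alpha> + (b / (a + b)) powr \<alpha>"
    using *[of "a / (a + b)"] *[of "b / (a + b)"] assms by auto
  also have "\<dots> = (a powr \<alpha> + b powr \<alpha>) / (a + b) powr \<alpha>"
    using assms by (simp add: powr_divide add_divide_distrib)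
  finally show ?thesis using assms by (simp add: field_simps)
qed

text \<open>Substitute \<open>\<tau> = t * x\<close>: the two powers of \<open>t\<close> multiply to
  \<open>1 / t\<close>, which cancels the Jacobian, so the value does not depend on
  \<open>t\<close>.\<close>

lemma has_bochner_integral_Beta_scaled:
  fixes \<alpha> t :: real
  assumes \<alpha>: "0 < \<alpha>" "\<alpha> < 1" and t: "0 < t"
  shows "has_bochner_integral lborel
      (\<lambda>\<tau>. indicator {0..t} \<tau> * ((t - \<tau>) powr (- \<alpha>) * \<tau> powr (\<alpha> - 1))) (Beta \<alpha> (1 - \<alpha>))"
proof -
  let ?f = "\<lambda>\<tau>. indicator {0..t} \<tau> * ((t - \<tau>) powr (- \<alpha>) * \<tau> powr (\<alpha> - 1))"
  let ?b = "\<lambda>x. indicator {0..1} x * (x powr (\<alpha> - 1) * (1 - x) powr (- \<alpha>))"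
  have i: "set_integrable lborel {0..1} (\<lambda>x. x powr (\<alpha> - 1) * (1 - x) powr (- \<alpha>))"
    using integrable_Beta[of \<alpha> "1 - \<alpha>"] \<alpha> by simp
  have "((\<lambda>x. x powr (\<alpha> - 1) * (1 - x) powr (- \<alpha>)) has_integral Beta \<alpha> (1 - \<alpha>)) {0..1}"
    using has_integral_Beta_real[of \<alpha> "1 - \<alpha>"] \<alpha> by simp
  hence "(LINT x|lborel. ?b x) = Beta \<alpha> (1 - \<alpha>)"
    using set_borel_integral_eq_integral(2)[OF i] integral_unique
    by (auto simp: set_lebesgue_integral_def)
  with i have b: "has_bochner_integral lborel ?b (Beta \<alpha> (1 - \<alpha>))"
    by (simp add: has_bochner_integral_iff set_integrable_def)
  have e: "?f (t * x) = ?b x / t" for x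
  proof (cases "0 < x \<and> x < 1")
    case True
    hence "(t - t * x) powr (- \<alpha>) * (t * x) powr (\<alpha> - 1)
        = t powr (- \<alpha> + (\<alpha> - 1)) * (x powr (\<alpha> - 1) * (1 - x) powr (- \<alpha>))"
    proof -
      have "t - t * x = t * (1 - x)" by (simp add: algebra_simps)
      thus ?thesis unfolding powr_add using t True by (simp add: powr_mult)
    qed
    also have "t powr (- \<alpha> + (\<alpha> - 1)) = 1 / t" using t by (simp add: powr_minus_divide)
    finally show ?thesis using True t by (auto split: split_indicator simp: mult_le_cancel_left1)
  next
    case False
    show ?thesis
    \<comment> \<open>At the two endpoints both sides are zero by the convention for powers of
      \<open>0\<close>.\<close>
    proof (cases "x = 0 \<or> x = 1")
      case True thus ?thesis using t by auto
    next
      case F: False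
      hence "x < 0 \<or> 1 < x" using False by auto
      thus ?thesis using t by (auto split: split_indicator simp: mult_le_cancel_left1 zero_le_mult_iff)
    qed
  qed
  have "integrable lborel (\<lambda>x. ?f (0 + t * x))"
    using b by (simp add: e has_bochner_integral_iff)
  hence "integrable lborel ?f" using lborel_integrable_real_affine_iff[of t ?f 0] t by simp
  moreover have "(LINT x|lborel. ?f x) = Beta \<alpha> (1 - \<alpha>)"
    using lborel_integral_real_affine[of t ?f 0] t b by (simp add: e has_bochner_integral_iff)
  ultimately show ?thesis by (simp add: has_bochner_integral_iff)
qed

lemma has_bochner_integral_shifted_powr:
  fixes \<beta> L t :: real
  assumes "0 < \<beta>" "0 < L" "0 \<le> t"
  shows "has_bochner_integral lborel (\<lambda>\<tau>. indicator {0..t} \<tau> * (L + \<tau>) powr (- \<beta> - 1))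
    ((L powr (- \<beta>) - (L + t) powr (- \<beta>)) / \<beta>)"
proof -
  have "has_bochner_integral lborel (\<lambda>\<tau>. (L + \<tau>) powr (- \<beta> - 1) * indicator {0..t} \<tau>)
      (- ((L + t) powr (- \<beta>)) / \<beta> - (- ((L + 0) powr (- \<beta>)) / \<beta>))"
    by (rule has_bochner_integral_FTC_Icc_real)
      (use assms in \<open>auto intro!: derivative_eq_intros continuous_intros simp: field_simps\<close>)
  thus ?thesis by (simp add: mult.commute diff_divide_distrib)
qed

text \<open>The weight \<open>(L + t) powr \<alpha>\<close> is split by subadditivity over \<open>L + t = (L + \<tau>) + (t - \<tau>)\<close>;
  one part is dominated by a Beta integral, the other one no longer contains the singular kernel.\<close>

lemma fractional_integral_shifted_powr_le:
  fixes \<alpha> \<beta> L t :: real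
  assumes \<alpha>: "0 < \<alpha>" "\<alpha> < 1" and \<beta>: "0 < \<beta>" and L: "0 < L" and t: "0 \<le> t"
  shows "(LINT \<tau>:{0..t}|lebesgue. (t - \<tau>) powr (- \<alpha>) * (L + \<tau>) powr (- \<beta> - 1))
    \<le> (Beta \<alpha> (1 - \<alpha>) + 1 / \<beta>) * L powr (- \<beta>) * (L + t) powr (- \<alpha>)"
proof (cases "t = 0")
  case True
  have "Beta \<alpha> (1 - \<alpha>) > 0" using \<alpha> by (simp add: Beta_def Gamma_real_pos)
  moreover have z: "indicator {0..t} \<tau> *\<^sub>R ((t - \<tau>) powr (- \<alpha>) * (L + \<tau>) powr (- \<beta> - 1)) = 0" for \<tau>
    using True by (auto split: split_indicator)
  ultimately show ?thesis unfolding set_lebesgue_integral_def z using \<beta> by simp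
next
  case False
  with t have t: "0 < t" by simp
  let ?K = "\<lambda>\<tau>. indicator {0..t} \<tau> * ((t - \<tau>) powr (- \<alpha>) * (L + \<tau>) powr (- \<beta> - 1))"
  let ?R1 = "\<lambda>\<tau>. indicator {0..t} \<tau> * ((t - \<tau>) powr (- \<alpha>) * \<tau> powr (\<alpha> - 1))"
  let ?R2 = "\<lambda>\<tau>. indicator {0..t} \<tau> * (L + \<tau>) powr (- \<beta> - 1)"
  have pt: "(L + t) powr \<alpha> * ((t - \<tau>) powr (- \<alpha>) * (L + \<tau>) powr (- \<beta> - 1))
      \<le> L powr (- \<beta>) * ((t - \<tau>) powr (- \<alpha>) * \<tau> powr (\<alpha> - 1)) + (L + \<tau>) powr (- \<beta> - 1)"
    if \<tau>: "0 < \<tau>" "\<tau> < t" for \<tau>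
  proof -
    have "(L + t) powr \<alpha> \<le> (L + \<tau>) powr \<alpha> + (t - \<tau>) powr \<alpha>"
      using powr_add_le[of "L + \<tau>" "t - \<tau>" \<alpha>] \<tau> L \<alpha> by simp
    hence "(L + t) powr \<alpha> * ((t - \<tau>) powr (- \<alpha>) * (L + \<tau>) powr (- \<beta> - 1))
       \<le> ((L + \<tau>) powr \<alpha> + (t - \<tau>) powr \<alpha>) * ((t - \<tau>) powr (- \<alpha>) * (L + \<tau>) powr (- \<beta> - 1))"
      by (intro mult_right_mono) auto
    also have "\<dots> = (t - \<tau>) powr (- \<alpha>) * ((L + \<tau>) powr \<alpha> * (L + \<tau>) powr (- \<beta> - 1))
       + ((t - \<tau>) powr \<alpha> * (t - \<tau>) powr (- \<alpha>)) * (L + \<tau>) powr (- \<beta> - 1)"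
      by (simp add: algebra_simps)
    also have "(t - \<tau>) powr \<alpha> * (t - \<tau>) powr (- \<alpha>) = 1" using \<tau> by (simp flip: powr_add)
    also have "(L + \<tau>) powr \<alpha> * (L + \<tau>) powr (- \<beta> - 1) = (L + \<tau>) powr (- \<beta>) * (L + \<tau>) powr (\<alpha> - 1)"
      by (simp flip: powr_add add: algebra_simps)
    \<comment> \<open>Both exponents \<open>- \<beta>\<close> and \<open>\<alpha> - 1\<close> are
      negative, so \<open>L + \<tau>\<close> may be lowered to \<open>L\<close> in one factor and to
      \<open>\<tau>\<close> in the other.\<close>
    also have "(t - \<tau>) powr (- \<alpha>) * ((L + \<tau>) powr (- \<beta>) * (L + \<tau>) powr (\<alpha> - 1))
        \<le> (t - \<tau>) powr (- \<alpha>) * (L powr (- \<beta>) * \<tau> powr (\<alpha> - 1))"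
      using \<tau> L \<alpha> \<beta> by (intro mult_left_mono mult_mono powr_mono2') auto
    finally show ?thesis by (simp add: mult_ac)
  qed
  have h1: "has_bochner_integral lborel ?R1 (Beta \<alpha> (1 - \<alpha>))"
    by (rule has_bochner_integral_Beta_scaled) (use \<alpha> t in auto)
  have h2: "has_bochner_integral lborel ?R2 ((L powr (- \<beta>) - (L + t) powr (- \<beta>)) / \<beta>)"
    by (rule has_bochner_integral_shifted_powr) (use \<beta> L t in auto)
  have h: "has_bochner_integral lborel (\<lambda>\<tau>. L powr (- \<beta>) * ?R1 \<tau> + ?R2 \<tau>)
      (L powr (- \<beta>) * Beta \<alpha> (1 - \<alpha>) + (L powr (- \<beta>) - (L + t) powr (- \<beta>)) / \<beta>)"
    by (intro has_bochner_integral_add has_bochner_integral_mult_right h1 h2)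
  have "(L + t) powr \<alpha> * (LINT \<tau>|lborel. ?K \<tau>) = (LINT \<tau>|lborel. (L + t) powr \<alpha> * ?K \<tau>)" by simp
  also have "\<dots> \<le> (LINT \<tau>|lborel. L powr (- \<beta>) * ?R1 \<tau> + ?R2 \<tau>)"
  proof (rule integral_mono_AE')
    show "integrable lborel (\<lambda>\<tau>. L powr (- \<beta>) * ?R1 \<tau> + ?R2 \<tau>)"
      using h by (simp add: has_bochner_integral_iff)
    show "AE \<tau> in lborel. (L + t) powr \<alpha> * ?K \<tau> \<le> L powr (- \<beta>) * ?R1 \<tau> + ?R2 \<tau>"
      using AE_lborel_singleton[of 0] AE_lborel_singleton[of t]
      by eventually_elim (use pt in \<open>auto split: split_indicator\<close>)
  qed (auto simp: AE_I2)
  also have "\<dots> = L powr (- \<beta>) * Beta \<alpha> (1 - \<alpha>) + (L powr (- \<beta>) - (L + t) powr (- \<beta>)) / \<beta>"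
    using h by (simp only: has_bochner_integral_iff)
  also have "\<dots> \<le> (Beta \<alpha> (1 - \<alpha>) + 1 / \<beta>) * L powr (- \<beta>)"
    using \<beta> by (simp add: field_simps)
  finally have "(LINT \<tau>|lborel. ?K \<tau>) \<le> (Beta \<alpha> (1 - \<alpha>) + 1 / \<beta>) * L powr (- \<beta>) * (L + t) powr (- \<alpha>)"
    using L t by (simp add: powr_minus field_simps)
  thus ?thesis
    by (simp add: set_lebesgue_integral_def integral_completion)
qed

text \<open>Fix the initial height \<open>a = B * L powr (- \<beta>)\<close>. As
  \<open>\<beta> * r = \<alpha>\<close>, the memory is at most
  \<open>D * (L + t) powr (- \<alpha>)\<close> with \<open>D\<close> independent of
  \<open>L\<close>, whereas the absorption equals
  \<open>c * a powr r * L powr \<alpha> * (L + t) powr (- \<alpha>)\<close>. The length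
  \<open>L\<close> is chosen to make these two expressions equal.\<close>

lemma exists_fractional_barrier:
  fixes \<alpha> r c A :: real
  assumes \<alpha>: "0 < \<alpha>" "\<alpha> < 1" and r: "0 < r" and c: "0 < c"
  defines "\<beta> \<equiv> \<alpha> / r"
  obtains B L where "0 < B" "0 < L" "A \<le> B * L powr (- \<beta>)"
    "\<And>t. 0 \<le> t \<Longrightarrow> \<beta> * B / Gamma (1 - \<alpha>)
       * (LINT \<tau>:{0..t}|lebesgue. (t - \<tau>) powr (- \<alpha>) * (L + \<tau>) powr (- \<beta> - 1))
       \<le> c * (B * (L + t) powr (- \<beta>)) powr r"
proof -
  have \<beta>: "0 < \<beta>" using \<alpha> r by (simp add: \<beta>_def)
  \<comment> \<open>The maximum with \<open>1\<close> keeps the height positive, as \<open>A\<close>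
    is an arbitrary real.\<close>
  define a where "a = max A 1"
  define D where "D = \<beta> * a * (Beta \<alpha> (1 - \<alpha>) + 1 / \<beta>) / Gamma (1 - \<alpha>)"
  define L where "L = (D / (c * a powr r)) powr (1 / \<alpha>)"
  define B where "B = a * L powr \<beta>"
  have a: "0 < a" by (simp add: a_def)
  have \<Gamma>: "0 < Gamma (1 - \<alpha>)" using \<alpha> by (simp add: Gamma_real_pos)
  have "Beta \<alpha> (1 - \<alpha>) > 0" using \<alpha> by (simp add: Beta_def Gamma_real_pos)
  hence D: "0 < D" using \<beta> a \<Gamma> by (simp add: D_def add_pos_pos)
  have L: "0 < L" using D c a by (simp add: L_def)
  have L\<alpha>: "L powr \<alpha> = D / (c * a powr r)" using D c a \<alpha> by (simp add: L_def powr_powr)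
  have B: "0 < B" using a L by (simp add: B_def)
  have BL: "B * L powr (- \<beta>) = a" using L by (simp add: B_def powr_minus)
  have \<beta>r: "\<beta> * r = \<alpha>" using r by (simp add: \<beta>_def)
  have "\<beta> * B / Gamma (1 - \<alpha>)
       * (LINT \<tau>:{0..t}|lebesgue. (t - \<tau>) powr (- \<alpha>) * (L + \<tau>) powr (- \<beta> - 1))
       \<le> c * (B * (L + t) powr (- \<beta>)) powr r" if t: "0 \<le> t" for t
  proof -
    have "\<beta> * B / Gamma (1 - \<alpha>)
       * (LINT \<tau>:{0..t}|lebesgue. (t - \<tau>) powr (- \<alpha>) * (L + \<tau>) powr (- \<beta> - 1))
      \<le> \<beta> * B / Gamma (1 - \<alpha>) * ((Beta \<alpha> (1 - \<alpha>) + 1 / \<beta>) * L powr (- \<beta>) * (L + t) powr (- \<alpha>))"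
      using \<beta> B \<Gamma> by (intro mult_left_mono fractional_integral_shifted_powr_le \<alpha> L t) auto
    also have "\<dots> = \<beta> * (B * L powr (- \<beta>)) * (Beta \<alpha> (1 - \<alpha>) + 1 / \<beta>) / Gamma (1 - \<alpha>) * (L + t) powr (- \<alpha>)"
      by simp
    also have "\<dots> = D * (L + t) powr (- \<alpha>)" by (simp only: BL D_def)
    also have "\<dots> = c * (a powr r * L powr \<alpha>) * (L + t) powr (- \<alpha>)"
      using c a by (simp add: L\<alpha>)
    also have "a powr r * L powr \<alpha> = B powr r"
      using a L \<beta>r by (simp add: B_def powr_mult powr_powr)
    also have "c * B powr r * (L + t) powr (- \<alpha>) = c * (B * (L + t) powr (- \<beta>)) powr r"
      using B L t \<beta>r by (simp add: powr_mult powr_powr)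
    finally show ?thesis .
  qed
  moreover have "A \<le> B * L powr (- \<beta>)" unfolding BL by (simp add: a_def)
  ultimately show thesis using that B L by blast
qed

section \<open>Comparison\<close>

lemma continuous_AE_zero:
  fixes f :: "real \<Rightarrow> real"
  assumes c: "continuous_on {a..b} f" and "a < b" and ae: "AE t\<in>{a<..<b} in lebesgue. f t = 0"
    and t: "t \<in> {a..b}"
  shows "f t = 0"
proof -
  have cl: "closed {x \<in> {a..b}. f x = 0}"
    using c by (intro continuous_closed_preimage_constant) auto
  \<comment> \<open>A closed set containing almost every point of an open interval contains all of
    it; continuity then adds the endpoints.\<close>
  have "AE x\<in>{a<..<b} in lebesgue. x \<in> {x \<in> {a..b}. f x = 0}"
    using ae by eventually_elim auto
  from mem_closed_if_AE_lebesgue_open[OF open_greaterThanLessThan cl this]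
have "\<And>x. x \<in> {a<..<b} \<Longrightarrow> f x = 0" by blast
  thus ?thesis
    using continuous_constant_on_closure[of "{a<..<b}" f 0 t] c t \<open>a < b\<close> by simp
qed

text \<open>\<open>\<Psi>\<close> is the time integrand at a fixed point of space once the nonlocal
  term is dropped. Its integral dominates the nonnegative memory energy of \<open>y - w\<close> plus
  the nonnegative absorption difference. Both conclusions are needed: the weak identity bounds only
  the integral over space, so the sign must hold on each trajectory before the equality case can be
  used.\<close>

lemma trajectory_comparison:
  fixes y :: "real \<Rightarrow> real" and \<alpha> r c T B L :: real
  assumes \<alpha>: "0 < \<alpha>" "\<alpha> < 1" and r: "0 < r" and c: "0 < c" and T: "0 < T"
    and B: "0 < B" and L: "0 < L"
  defines "\<beta> \<equiv> \<alpha> / r"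
  defines "w \<equiv> \<lambda>t. B * (L + t) powr (- \<beta>)"
  assumes barrier: "\<And>t. 0 \<le> t \<Longrightarrow> \<beta> * B / Gamma (1 - \<alpha>)
       * (LINT \<tau>:{0..t}|lebesgue. (t - \<tau>) powr (- \<alpha>) * (L + \<tau>) powr (- \<beta> - 1)) \<le> c * w t powr r"
    and y: "abs_cont_on 0 T y" and y0: "0 \<le> y 0" "y 0 \<le> w 0" and ypos: "\<And>t. 0 < t \<Longrightarrow> 0 < y t"
  defines "\<Psi> \<equiv> \<lambda>t. indicator {0<..<T} t
      * ((caputo \<alpha> y t + c * (\<bar>y t\<bar> powr (r - 1) * y t)) * max 0 (y t - w t))"
  assumes \<Psi>: "integrable lebesgue \<Psi>"
  shows "0 \<le> integral\<^sup>L lebesgue \<Psi>"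
    and "integral\<^sup>L lebesgue \<Psi> = 0 \<Longrightarrow> t \<in> {0..T} \<Longrightarrow> y t \<le> w t"
proof -
  have \<beta>: "0 < \<beta>" using \<alpha> r by (simp add: \<beta>_def)
  have \<Gamma>: "0 < Gamma (1 - \<alpha>)" using \<alpha> by (simp add: Gamma_real_pos)
  define e where "e \<tau> = (L + \<tau>) powr (- \<beta> - 1)" for \<tau>
  \<comment> \<open>\<open>g\<close> plays the role of the derivative of \<open>v\<close>: that of
    the barrier is \<open>- \<beta> * B * e \<tau>\<close>.\<close>
  define g where "g \<tau> = deriv y \<tau> + \<beta> * B * e \<tau>" for \<tau>
  define v where "v t = y t - w t" for t
  define J where "J t = (LINT \<tau>:{0..t}|lebesgue. (t - \<tau>) powr (- \<alpha>) * g \<tau>)" for t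
  define K where "K t = (LINT \<tau>:{0..t}|lebesgue. (t - \<tau>) powr (- \<alpha>) * e \<tau>)" for t
  have e: "set_integrable lebesgue {0..t} e"
    "(LINT \<tau>:{0..t}|lebesgue. e \<tau>) = (L powr (- \<beta>) - (L + t) powr (- \<beta>)) / \<beta>" if "0 \<le> t" for t
  proof -
    have h: "has_bochner_integral lborel (\<lambda>\<tau>. indicator {0..t} \<tau> *\<^sub>R e \<tau>)
        ((L powr (- \<beta>) - (L + t) powr (- \<beta>)) / \<beta>)"
      using has_bochner_integral_shifted_powr[OF \<beta> L that] by (simp add: e_def)
    hence m: "(\<lambda>\<tau>. indicator {0..t} \<tau> *\<^sub>R e \<tau>) \<in> borel_measurable lborel"
      by (rule borel_measurable_has_bochner_integral)
    show "set_integrable lebesgue {0..t} e"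
      unfolding set_integrable_def integrable_completion[OF m] using h by (rule integrable.intros)
    show "(LINT \<tau>:{0..t}|lebesgue. e \<tau>) = (L powr (- \<beta>) - (L + t) powr (- \<beta>)) / \<beta>"
      unfolding set_lebesgue_integral_def integral_completion[OF m]
      using h by (rule has_bochner_integral_integral_eq)
  qed
  have dy: "set_integrable lebesgue {0..T} (deriv y)"
    "\<And>t. t \<in> {0..T} \<Longrightarrow> y t = y 0 + (LINT \<tau>:{0..t}|lebesgue. deriv y \<tau>)"
    using y unfolding abs_cont_on_def by blast+
  have gi: "set_integrable lebesgue {0..T} g"
  proof -
    have "set_integrable lebesgue {0..T} (\<lambda>\<tau>. \<beta> * B * e \<tau>)" using e(1)[of T] T by simp
    from set_integral_add(1)[OF dy(1) this] show ?thesis by (simp add: g_def[abs_def])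
  qed
  have vr: "v t = (y 0 - w 0) + (LINT \<tau>:{0..t}|lebesgue. g \<tau>)" if t: "t \<in> {0..T}" for t
  proof -
    have i: "set_integrable lebesgue {0..t} (deriv y)"
      by (rule set_integrable_subset[OF dy(1)]) (use t in auto)
    have "(LINT \<tau>:{0..t}|lebesgue. g \<tau>)
        = (LINT \<tau>:{0..t}|lebesgue. deriv y \<tau>) + \<beta> * B * (LINT \<tau>:{0..t}|lebesgue. e \<tau>)"
    proof -
      have "set_integrable lebesgue {0..t} (\<lambda>\<tau>. \<beta> * B * e \<tau>)" using e(1)[of t] t by simp
      from set_integral_add(2)[OF i this] show ?thesis unfolding g_def by simp
    qed
    also have "\<beta> * B * (LINT \<tau>:{0..t}|lebesgue. e \<tau>) = w 0 - w t"
      proof -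
      have "\<beta> * (LINT \<tau>:{0..t}|lebesgue. e \<tau>) = L powr (- \<beta>) - (L + t) powr (- \<beta>)"
        using e(2)[of t] t \<beta> by simp
      hence "B * (\<beta> * (LINT \<tau>:{0..t}|lebesgue. e \<tau>)) = B * L powr (- \<beta>) - B * (L + t) powr (- \<beta>)"
        by (simp only: right_diff_distrib)
      thus ?thesis by (simp add: w_def mult_ac)
    qed
    finally show ?thesis unfolding v_def using dy(2)[OF t] by linarith
  qed
  have v0: "y 0 - w 0 \<le> 0" using y0 by simp
  have E: "AE t in lebesgue. t \<in> {0..T} \<longrightarrow>
        set_integrable lebesgue {0..t} (\<lambda>\<tau>. (t - \<tau>) powr (- \<alpha>) * g \<tau>)"
    "set_integrable lebesgue {0..T} (\<lambda>t. max 0 (v t) * J t)"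
    "0 \<le> (LINT t:{0..T}|lebesgue. max 0 (v t) * J t)"
    "continuous_on {0..T} v"
    unfolding J_def by (rule caputo_energy[OF \<alpha> T v0 gi vr]; assumption)+
  \<comment> \<open>Only the integrability of the memory integrand is taken from the energy lemma
    here, with \<open>e\<close> as derivative of a function starting at zero.\<close>
  have Ew: "AE t in lebesgue. t \<in> {0..T} \<longrightarrow> set_integrable lebesgue {0..t} (\<lambda>\<tau>. (t - \<tau>) powr (- \<alpha>) * e \<tau>)"
    by (rule caputo_energy(1)[where v="\<lambda>t. 0 + (LINT \<tau>:{0..t}|lebesgue. e \<tau>)" and ?v0.0 = 0])
      (use \<alpha> T e(1)[of T] in simp_all)
  \<comment> \<open>Splitting \<open>deriv y\<close> into \<open>g\<close> and the barrier part
    requires both memory integrals to converge, hence only almost every \<open>t\<close>. The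
    barrier part is then bounded by \<open>c * w t powr r\<close>.\<close>
  have caputo: "AE t in lebesgue. t \<in> {0..T} \<longrightarrow> J t / Gamma (1 - \<alpha>) - c * w t powr r \<le> caputo \<alpha> y t"
    using E(1) Ew
  proof eventually_elim
    case (elim t)
    show ?case
    proof
      assume t: "t \<in> {0..T}"
      have i: "set_integrable lebesgue {0..t} (\<lambda>\<tau>. (t - \<tau>) powr (- \<alpha>) * g \<tau>)"
        "set_integrable lebesgue {0..t} (\<lambda>\<tau>. \<beta> * B * ((t - \<tau>) powr (- \<alpha>) * e \<tau>))"
        using elim t by auto
      have "(LINT \<tau>:{0..t}|lebesgue. (t - \<tau>) powr (- \<alpha>) * deriv y \<tau>)
          = (LINT \<tau>:{0..t}|lebesgue. (t - \<tau>) powr (- \<alpha>) * g \<tau> - \<beta> * B * ((t - \<tau>) powr (- \<alpha>) * e \<tau>))"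
        by (simp add: g_def algebra_simps)
      also have "\<dots> = J t - \<beta> * B * K t"
        using set_integral_diff(2)[OF i] by (simp add: J_def K_def)
      finally have "caputo \<alpha> y t = J t / Gamma (1 - \<alpha>) - \<beta> * B / Gamma (1 - \<alpha>) * K t"
        by (simp add: caputo_def diff_divide_distrib)
      thus "J t / Gamma (1 - \<alpha>) - c * w t powr r \<le> caputo \<alpha> y t"
        using barrier[of t] t by (simp add: K_def e_def)
    qed
  qed
  have wc: "continuous_on {0..T} w"
    unfolding w_def using L by (intro continuous_intros) auto
  have "continuous_on {0..T} (\<lambda>t. v t + w t)" by (intro continuous_intros E(4) wc)
  hence yc: "continuous_on {0..T} y" by (simp add: v_def)
  have wpos: "0 < w t" if "0 \<le> t" for t using that B L by (simp add: w_def)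
  have ynn: "0 \<le> y t" if "0 \<le> t" for t using that y0(1) ypos[of t] by (cases "t = 0") auto
  \<comment> \<open>The gain in absorption from \<open>w\<close> to \<open>y\<close>, weighted by
    the positive part of \<open>v\<close>; it is nonnegative because the power is
    increasing.\<close>
  define D where "D t = indicator {0..T} t * (c * (y t powr r - w t powr r) * max 0 (v t))" for t
  have Dc: "continuous_on {0..T} (\<lambda>t. c * (y t powr r - w t powr r) * max 0 (v t))"
  proof -
    have "continuous_on {0..T} (\<lambda>t. y t powr r)"
      by (rule continuous_on_powr'[OF yc continuous_on_const]) (use ynn r in auto)
    moreover have "continuous_on {0..T} (\<lambda>t. w t powr r)"
      by (rule continuous_on_powr'[OF wc continuous_on_const]) (use wpos r in \<open>auto simp: less_imp_le\<close>)
    ultimately show ?thesis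
      by (intro continuous_on_mult continuous_on_diff continuous_on_max continuous_on_const E(4))
  qed
  have Di: "integrable lebesgue D"
  proof -
    have h: "integrable lborel D"
      using borel_integrable_atLeastAtMost'[OF Dc]
      unfolding set_integrable_def real_scaleR_def D_def[abs_def] .
    show ?thesis using integrable_completion[OF borel_measurable_integrable[OF h]] h by blast
  qed
  have Dnn: "0 \<le> D t" for t
  proof (cases "t \<in> {0..T} \<and> 0 < v t")
    case True
    hence "w t powr r \<le> y t powr r" using wpos[of t] r by (intro powr_mono2) (auto simp: v_def)
    thus ?thesis using c by (auto simp: D_def)
  next
    case False
    thus ?thesis by (auto simp: D_def max_def split: split_indicator)
  qed
  define Z where "Z t = indicator {0..T} t * (max 0 (v t) * J t)" for t
  have Zi: "integrable lebesgue Z" "0 \<le> integral\<^sup>L lebesgue Z"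
    using E(2,3) by (auto simp: Z_def[abs_def] set_integrable_def set_lebesgue_integral_def)
  \<comment> \<open>\<open>\<Psi>\<close> lives on the open interval, \<open>Z\<close> and
    \<open>D\<close> on the closed one, so the endpoints are discarded.\<close>
  have "AE t in lebesgue. t \<noteq> 0" "AE t in lebesgue. t \<noteq> T"
    by (auto intro: AE_completion AE_lborel_singleton)
  hence lower: "AE t in lebesgue. Z t / Gamma (1 - \<alpha>) + D t \<le> \<Psi> t"
    using caputo
  proof eventually_elim
    case (elim t)
    show ?case
    proof (cases "t \<in> {0<..<T}")
      case True
      have p: "\<bar>y t\<bar> powr (r - 1) * y t = y t powr r"
        using ypos[of t] True by (simp add: powr_diff)
      have "Z t / Gamma (1 - \<alpha>) + D t
          = (J t / Gamma (1 - \<alpha>) - c * w t powr r + c * y t powr r) * max 0 (v t)"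
        using True by (simp add: Z_def D_def algebra_simps)
      also have "\<dots> \<le> (caputo \<alpha> y t + c * y t powr r) * max 0 (v t)"
        using elim True by (intro mult_right_mono) auto
      also have "\<dots> = \<Psi> t"
        using True by (simp add: \<Psi>_def p v_def)
      finally show ?thesis .
    next
      case False
      hence "t \<notin> {0..T}" using elim by auto
      thus ?thesis using False by (simp add: Z_def D_def \<Psi>_def)
    qed
  qed
  have "0 \<le> integral\<^sup>L lebesgue D" using Dnn by (intro Bochner_Integration.integral_nonneg)
  moreover have key: "integral\<^sup>L lebesgue D \<le> integral\<^sup>L lebesgue \<Psi>"
  proof -
    have "integral\<^sup>L lebesgue D \<le> integral\<^sup>L lebesgue Z / Gamma (1 - \<alpha>) + integral\<^sup>L lebesgue D"
      using Zi(2) \<Gamma> by simp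
    also have "\<dots> = (LINT t|lebesgue. Z t / Gamma (1 - \<alpha>) + D t)" using Zi(1) Di by simp
    also have "\<dots> \<le> integral\<^sup>L lebesgue \<Psi>"
      by (rule integral_mono_AE[OF _ \<Psi> lower]) (intro Bochner_Integration.integrable_add Bochner_Integration.integrable_divide Zi(1) Di)
    finally show ?thesis .
  qed
  ultimately show "0 \<le> integral\<^sup>L lebesgue \<Psi>" by simp
  show "y t \<le> w t" if z: "integral\<^sup>L lebesgue \<Psi> = 0" and t: "t \<in> {0..T}"
  proof -
    have "integral\<^sup>L lebesgue D = 0" using key z \<open>0 \<le> integral\<^sup>L lebesgue D\<close> by simp
    hence "AE t in lebesgue. D t = 0" using integral_nonneg_eq_0_iff_AE[OF Di] Dnn by simp
    \<comment> \<open>Strict monotonicity of the power makes \<open>D\<close> positive wherever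
      \<open>v\<close> is.\<close>
    hence "AE t\<in>{0<..<T} in lebesgue. max 0 (v t) = 0"
    proof eventually_elim
      case (elim t)
      show ?case
      proof (rule impI, rule ccontr)
        assume t: "t \<in> {0<..<T}" and "max 0 (v t) \<noteq> 0"
        hence p: "0 < v t" by (auto simp: max_def split: if_splits)
        hence "w t powr r < y t powr r"
          using wpos[of t] t r by (intro powr_less_mono2) (auto simp: v_def)
        hence "0 < D t" using p c t by (simp add: D_def)
        with elim show False by simp
      qed
    qed
    moreover have "continuous_on {0..T} (\<lambda>t. max 0 (v t))"
      by (intro continuous_on_max continuous_on_const E(4))
    ultimately have "max 0 (v t) = 0"
      using continuous_AE_zero[of 0 T "\<lambda>t. max 0 (v t)" t] T t by blast
    hence "v t \<le> 0" by linarith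
    thus ?thesis by (simp add: v_def)
  qed
qed

section \<open>Truncations of the solution as test functions\<close>

lemma Lp_on_dominated:
  fixes f h :: "'a::euclidean_space \<Rightarrow> real"
  assumes p: "0 < p" and f: "f \<in> Lp_on p S" and h: "h \<in> borel_measurable lebesgue"
    and le: "\<And>x. \<bar>h x\<bar> \<le> indicator S x * \<bar>f x\<bar>"
  shows "h \<in> Lp_on p UNIV" and "Lp_norm_on p UNIV h \<le> Lp_norm_on p S f"
proof -
  have fi: "integrable lebesgue (\<lambda>x. indicator S x * \<bar>f x\<bar> powr p)"
    using f by (simp add: Lp_on_def set_integrable_def)
  have le': "\<bar>h x\<bar> powr p \<le> indicator S x * \<bar>f x\<bar> powr p" for x
  proof (cases "x \<in> S")
    case True
    thus ?thesis using le[of x] p by (simp add: powr_mono2)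
  next
    case False
    thus ?thesis using le[of x] by simp
  qed
  have hm: "(\<lambda>x. \<bar>h x\<bar> powr p) \<in> borel_measurable lebesgue" using h by measurable
  have hi: "integrable lebesgue (\<lambda>x. \<bar>h x\<bar> powr p)"
    by (rule Bochner_Integration.integrable_bound[OF fi hm]) (use le' in simp)
  show "h \<in> Lp_on p UNIV"
    using h hi by (simp add: Lp_on_def set_borel_measurable_def set_integrable_def)
  have "(LINT x|lebesgue. \<bar>h x\<bar> powr p) \<le> (LINT x|lebesgue. indicator S x * \<bar>f x\<bar> powr p)"
    by (rule integral_mono[OF hi fi le'])
  thus "Lp_norm_on p UNIV h \<le> Lp_norm_on p S f"
    unfolding Lp_norm_on_def set_lebesgue_integral_def using p
    by (intro powr_mono2) (simp_all add: Bochner_Integration.integral_nonneg)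
qed

text \<open>Truncation is 1-Lipschitz, so difference quotients do not grow. As
  \<open>0 \<le> c\<close> it sends \<open>0\<close> to \<open>0\<close>, so \<open>h\<close>
  vanishes outside \<open>\<Omega>\<close> and its quotient vanishes outside the Gagliardo region;
  norms over the whole space are thus controlled by those of \<open>f\<close>.\<close>

lemma truncation_Wsp0:
  fixes f :: "'a::euclidean_space \<Rightarrow> real"
  assumes p: "0 < p" and f: "f \<in> Wsp s p \<Omega>" and c: "0 \<le> c"
  defines "h \<equiv> \<lambda>x. max 0 (f x - c)"
  shows "h \<in> Wsp0 s p \<Omega>" and "Wsp_norm s p UNIV h \<le> Wsp_norm s p \<Omega> f"
proof -
  have fz: "f x = 0" if "x \<notin> \<Omega>" for x using f that by (auto simp: Wsp_def)
  have fL: "f \<in> Lp_on p \<Omega>" and fQ: "gagliardo_quotient s p f \<in> Lp_on p (gagliardo_region \<Omega>)"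
    using f by (auto simp: Wsp_def)
  have "(\<lambda>x. indicator \<Omega> x *\<^sub>R f x) = f" using fz by (auto split: split_indicator)
  hence fm[measurable]: "f \<in> borel_measurable lebesgue"
    using fL by (simp add: Lp_on_def set_borel_measurable_def)
  have hm[measurable]: "h \<in> borel_measurable lebesgue" unfolding h_def by measurable
  have hf: "\<bar>h x\<bar> \<le> indicator \<Omega> x * \<bar>f x\<bar>" for x
    using fz[of x] c by (cases "x \<in> \<Omega>") (auto simp: h_def)
  have reg: "gagliardo_region (UNIV :: 'a set) = UNIV" by (auto simp: gagliardo_region_def)
  have q: "\<bar>gagliardo_quotient s p h z\<bar>
      \<le> indicator (gagliardo_region \<Omega>) z * \<bar>gagliardo_quotient s p f z\<bar>" for z
  proof -
    obtain x y where z: "z = (x, y)" by (cases z)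
    show ?thesis
    proof (cases "z \<in> gagliardo_region \<Omega>")
      case True
      have "\<bar>h x - h y\<bar> \<le> \<bar>f x - f y\<bar>" by (auto simp: h_def)
      thus ?thesis using True by (simp add: gagliardo_quotient_def z divide_right_mono)
    next
      case False
      hence "h x = 0" "h y = 0" using fz[of x] fz[of y] c by (auto simp: gagliardo_region_def z h_def)
      thus ?thesis by (simp add: gagliardo_quotient_def z)
    qed
  qed
  have qm: "gagliardo_quotient s p h \<in> borel_measurable lebesgue"
  proof -
    have [measurable]: "(\<lambda>z::'a \<times> 'a. h (fst z)) \<in> borel_measurable lebesgue"
      "(\<lambda>z::'a \<times> 'a. h (snd z)) \<in> borel_measurable lebesgue"
      by (rule borel_measurable_lebesgue_fst_snd[OF hm])+
    have "(\<lambda>z::'a \<times> 'a. norm (fst z - snd z)) \<in> borel_measurable borel"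
      by (intro borel_measurable_continuous_onI continuous_intros)
    hence [measurable]: "(\<lambda>z::'a \<times> 'a. norm (fst z - snd z)) \<in> borel_measurable lebesgue"
      by (simp add: measurable_completion)
    show ?thesis unfolding gagliardo_quotient_def case_prod_beta by measurable
  qed
  note L = Lp_on_dominated[OF p fL hm hf] and Q = Lp_on_dominated[OF p fQ qm q]
  show "h \<in> Wsp0 s p \<Omega>"
    using L(1) Q(1) hf by (auto simp: Wsp0_def Wsp_def reg h_def fz c)
  show "Wsp_norm s p UNIV h \<le> Wsp_norm s p \<Omega> f"
    unfolding Wsp_norm_def reg using L(2) Q(2) by (rule add_mono)
qed

text \<open>At each time the level \<open>w t\<close> is a nonnegative constant in space, so
  \<open>truncation_Wsp0\<close> applies slice by slice with the same bound \<open>K\<close>. The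
  boundary condition holds because an open set misses its frontier, where \<open>u\<close> is
  zero.\<close>

lemma truncation_test_function:
  fixes u :: "'a::euclidean_space \<Rightarrow> real \<Rightarrow> real" and w :: "real \<Rightarrow> real"
  assumes p: "0 < p" and \<Omega>: "open \<Omega>"
    and u: "u \<in> Linf_time T (Wsp s p \<Omega>) (Wsp_norm s p \<Omega>) \<Omega>"
    and uz: "\<And>x t. x \<notin> \<Omega> \<Longrightarrow> t \<in> {0<..<T} \<Longrightarrow> u x t = 0"
    and w: "w \<in> borel_measurable borel" "\<And>t. 0 < t \<Longrightarrow> 0 \<le> w t"
  shows "(\<lambda>x t. max 0 (u x t - w t)) \<in> test_functions s p \<Omega> T"
proof -
  have um: "(\<lambda>z. indicator (\<Omega> \<times> {0<..<T}) z *\<^sub>R (case z of (x, t) \<Rightarrow> u x t)) \<in> borel_measurable lebesgue"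
    using u by (simp add: Linf_time_def set_borel_measurable_def)
  have S: "\<Omega> \<times> {0<..<T} \<in> sets lebesgue"
    using open_Times[OF \<Omega>, of "{0<..<T}"] by auto
  have wm: "(\<lambda>z::'a \<times> real. w (snd z)) \<in> borel_measurable lebesgue"
    by (rule borel_measurable_lebesgue_fst_snd(2)) (use w(1) in \<open>simp add: measurable_completion\<close>)
  \<comment> \<open>Joint measurability of \<open>u\<close> is known only on the space-time
    cylinder, so the truncation is performed on the extension by zero.\<close>
  define U where "U z = indicator (\<Omega> \<times> {0<..<T}) z *\<^sub>R (case z of (x, t) \<Rightarrow> u x t)" for z
  have [measurable]: "U \<in> borel_measurable lebesgue" using um by (simp add: U_def[abs_def])
  note [measurable] = wm S
  have "(\<lambda>z. indicator (\<Omega> \<times> {0<..<T}) z *\<^sub>R max 0 (U z - w (snd z))) \<in> borel_measurable lebesgue"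
    by measurable
  also have "(\<lambda>z. indicator (\<Omega> \<times> {0<..<T}) z *\<^sub>R max 0 (U z - w (snd z)))
      = (\<lambda>z. indicator (\<Omega> \<times> {0<..<T}) z *\<^sub>R (case z of (x, t) \<Rightarrow> max 0 (u x t - w t)))"
    by (auto simp: U_def split: split_indicator)
  finally have m: "set_borel_measurable lebesgue (\<Omega> \<times> {0<..<T}) (\<lambda>(x, t). max 0 (u x t - w t))"
    by (simp add: set_borel_measurable_def)
  obtain K where K: "AE t in lebesgue. t \<in> {0<..<T} \<longrightarrow>
      (\<lambda>x. u x t) \<in> Wsp s p \<Omega> \<and> Wsp_norm s p \<Omega> (\<lambda>x. u x t) \<le> K"
    using u by (auto simp: Linf_time_def)
  have "AE t in lebesgue. t \<in> {0<..<T} \<longrightarrow> (\<lambda>x. max 0 (u x t - w t)) \<in> Wsp0 s p \<Omega>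
      \<and> Wsp_norm s p UNIV (\<lambda>x. max 0 (u x t - w t)) \<le> K"
    using K
  proof eventually_elim
    case (elim t)
    thus ?case using truncation_Wsp0[OF p, of "\<lambda>x. u x t" s \<Omega> "w t"] w(2)[of t]
      by (meson greaterThanLessThan_iff order_trans)
  qed
  moreover have "x \<notin> \<Omega>" if "x \<in> frontier \<Omega>" for x
    using that \<Omega> by (auto simp: frontier_def interior_open)
  hence "max 0 (u x t - w t) = 0" if "x \<in> frontier \<Omega>" "t \<in> {0<..<T}" for x t
    using that uz[of x t] w(2)[of t] by auto
  ultimately show ?thesis
    using m by (auto simp: test_functions_def Linf_time_def)
qed

section \<open>Signs in the weak identity and comparison in space-time\<close>

lemma space_integrand_truncation_nonneg:
  "0 \<le> space_integrand s p u (\<lambda>x t. max 0 (u x t - w t)) z"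
proof -
  \<comment> \<open>The level is the same at both points, so the two differences have the same
    sign.\<close>
  have *: "0 \<le> (a - b) * (max 0 (a - c) - max 0 (b - c))" for a b c :: real
    by (cases "b \<le> a") (auto intro!: mult_nonneg_nonneg mult_nonpos_nonpos)
  obtain x y t where z: "z = (x, y, t)" by (cases z)
  have "0 \<le> \<bar>u x t - u y t\<bar> powr (p - 2) / norm (x - y) powr (real DIM('a) + s * p)
      * ((u x t - u y t) * (max 0 (u x t - w t) - max 0 (u y t - w t)))"
    by (intro mult_nonneg_nonneg * divide_nonneg_nonneg) auto
  thus ?thesis by (simp add: space_integrand_def z mult_ac)
qed

text \<open>All three cases are one absorption law: \<open>c\<close> is
  \<open>- (\<gamma> + \<mu>)\<close>, \<open>- \<gamma>\<close> or \<open>- \<mu>\<close>. In the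
  first case the two powers coincide, since \<open>q - 2 = m - 1\<close>.\<close>

lemma absorption_coefficient:
  fixes \<gamma> \<mu> m q r :: real
  assumes "(m = q - 1 \<and> q - 1 > 0 \<and> \<gamma> + \<mu> < 0 \<and> (r = m \<or> r = q - 1)) \<or>
         (m > 0 \<and> q > 1 \<and> \<gamma> < 0 \<and> \<mu> = 0 \<and> r = m) \<or>
         (m > 0 \<and> q > 1 \<and> \<gamma> = 0 \<and> \<mu> < 0 \<and> r = q - 1)"
  obtains c where "0 < c" "0 < r"
    "\<And>(u :: 'a \<Rightarrow> real \<Rightarrow> real) \<phi> z. power_integrand \<gamma> (m - 1) u \<phi> z
      + power_integrand \<mu> (q - 2) u \<phi> z = - c * power_integrand 1 (r - 1) u \<phi> z"
proof -
  let ?P = "\<lambda>c. \<forall>(u :: 'a \<Rightarrow> real \<Rightarrow> real) \<phi> z. power_integrand \<gamma> (m - 1) u \<phi> z + power_integrand \<mu> (q - 2) u \<phi> z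
      = - c * power_integrand 1 (r - 1) u \<phi> z"
  consider "m = q - 1" "r = m" "0 < r" "\<gamma> + \<mu> < 0" | "\<gamma> < 0" "\<mu> = 0" "r = m" "0 < r"
    | "\<gamma> = 0" "\<mu> < 0" "r = q - 1" "0 < r"
    using assms by fastforce
  hence "\<exists>c>0. 0 < r \<and> ?P c"
  proof cases
    case 1
    have "q - 2 = r - 1" using 1 by simp
    hence "?P (- (\<gamma> + \<mu>))" using 1 by (auto simp: power_integrand_def algebra_simps)
    thus ?thesis using 1 by (intro exI[of _ "- (\<gamma> + \<mu>)"]) auto
  next
    case 2
    hence "?P (- \<gamma>)" by (auto simp: power_integrand_def)
    thus ?thesis using 2 by (intro exI[of _ "- \<gamma>"]) auto
  next
    case 3
    have "q - 2 = r - 1" using 3 by simp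
    hence "?P (- \<mu>)" using 3 by (auto simp: power_integrand_def)
    thus ?thesis using 3 by (intro exI[of _ "- \<mu>"]) auto
  qed
  thus thesis using that by blast
qed

text \<open>Moving the reaction terms to the left shows that the integral of \<open>F\<close> is
  minus the nonlocal term, hence nonpositive.\<close>

lemma weak_identity_absorption:
  fixes \<Omega> :: "'a::euclidean_space set"
  assumes W: "weak_identity \<alpha> s p \<gamma> \<mu> m q \<Omega> T u \<phi>" and c: "0 < c"
    and P: "\<And>z. power_integrand \<gamma> (m - 1) u \<phi> z + power_integrand \<mu> (q - 2) u \<phi> z
      = - c * power_integrand 1 (r - 1) u \<phi> z"
    and S: "\<And>z. 0 \<le> space_integrand s p u \<phi> z"
  defines "F \<equiv> \<lambda>z. indicator (\<Omega> \<times> {0<..<T}) z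
      * (time_integrand \<alpha> u \<phi> z + c * power_integrand 1 (r - 1) u \<phi> z)"
  shows "integrable lebesgue F" and "integral\<^sup>L lebesgue F \<le> 0"
proof -
  let ?S = "\<Omega> \<times> {0<..<T}"
  have ti: "set_integrable lebesgue ?S (time_integrand \<alpha> u \<phi>)"
    and gi: "set_integrable lebesgue ?S (power_integrand \<gamma> (m - 1) u \<phi>)"
    and mi: "set_integrable lebesgue ?S (power_integrand \<mu> (q - 2) u \<phi>)"
    and eq: "(LINT z:?S|lebesgue. time_integrand \<alpha> u \<phi> z)
       + (LINT z:\<Omega> \<times> \<Omega> \<times> {0<..<T}|lebesgue. space_integrand s p u \<phi> z)
     = (LINT z:?S|lebesgue. power_integrand \<gamma> (m - 1) u \<phi> z)
       + (LINT z:?S|lebesgue. power_integrand \<mu> (q - 2) u \<phi> z)"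
    using W unfolding weak_identity_def by blast+
  \<comment> \<open>The absorption is kept as the sum of the two reaction terms, whose integrability
    is part of the weak identity.\<close>
  let ?R = "\<lambda>z. power_integrand \<gamma> (m - 1) u \<phi> z + power_integrand \<mu> (q - 2) u \<phi> z"
  have Ri: "set_integrable lebesgue ?S ?R" by (rule set_integral_add(1)[OF gi mi])
  have F: "F = (\<lambda>z. indicator ?S z *\<^sub>R (time_integrand \<alpha> u \<phi> z - ?R z))"
    unfolding F_def P by simp
  show "integrable lebesgue F"
    unfolding F using set_integral_diff(1)[OF ti Ri] by (simp add: set_integrable_def)
  have "integral\<^sup>L lebesgue F = (LINT z:?S|lebesgue. time_integrand \<alpha> u \<phi> z) - (LINT z:?S|lebesgue. ?R z)"
    unfolding F using set_integral_diff(2)[OF ti Ri] by (simp add: set_lebesgue_integral_def)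
  also have "\<dots> = - (LINT z:\<Omega> \<times> \<Omega> \<times> {0<..<T}|lebesgue. space_integrand s p u \<phi> z)"
    using set_integral_add(2)[OF gi mi] eq by simp
  also have "\<dots> \<le> 0"
    unfolding set_lebesgue_integral_def
    by (simp add: Bochner_Integration.integral_nonneg S)
  finally show "integral\<^sup>L lebesgue F \<le> 0" .
qed

text \<open>By Fubini the integral of \<open>F\<close> is the integral over space of the time
  integrals \<open>I x\<close>. Each is nonnegative by \<open>trajectory_comparison\<close> while
  their total is nonpositive, so almost all vanish and the equality case gives the bound. The
  coupling between points enters only through the sign of the nonlocal term.\<close>

lemma weak_solution_le_barrier:
  fixes \<Omega> :: "'a::euclidean_space set" and u0 :: "'a \<Rightarrow> real"
  assumes \<Omega>: "open \<Omega>" and \<alpha>: "0 < \<alpha>" "\<alpha> < 1" and p: "0 < p" and T: "0 < T"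
    and c: "0 < c" and r: "0 < r"
    and P: "\<And>u \<phi> z. power_integrand \<gamma> (m - 1) u \<phi> z + power_integrand \<mu> (q - 2) u \<phi> z
      = - c * power_integrand 1 (r - 1) u \<phi> (z :: 'a \<times> real)"
    and B: "0 < B" and L: "0 < L"
    and barrier: "\<And>t. 0 \<le> t \<Longrightarrow> \<alpha> / r * B / Gamma (1 - \<alpha>)
       * (LINT \<tau>:{0..t}|lebesgue. (t - \<tau>) powr (- \<alpha>) * (L + \<tau>) powr (- (\<alpha> / r) - 1))
       \<le> c * (B * (L + t) powr (- (\<alpha> / r))) powr r"
    and u0: "AE x in lebesgue. x \<in> \<Omega> \<longrightarrow> 0 \<le> u0 x \<and> u0 x \<le> B * L powr (- (\<alpha> / r))"
    and W: "weak_solution \<alpha> s p \<gamma> \<mu> m q \<Omega> u0 T u"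
    and pos: "AE x in lebesgue. x \<in> \<Omega> \<longrightarrow> (\<forall>t>0. 0 < u x t)"
  shows "AE x in lebesgue. x \<in> \<Omega> \<longrightarrow> (\<forall>t\<in>{0..T}. u x t \<le> B * (L + t) powr (- (\<alpha> / r)))"
proof -
  define w where "w t = B * (L + t) powr (- (\<alpha> / r))" for t
  define \<phi> where "\<phi> x t = max 0 (u x t - w t)" for x t
  define F where "F z = indicator (\<Omega> \<times> {0<..<T}) z
      * (time_integrand \<alpha> u \<phi> z + c * power_integrand 1 (r - 1) u \<phi> z)" for z
  have uW: "u \<in> Linf_time T (Wsp s p \<Omega>) (Wsp_norm s p \<Omega>) \<Omega>"
    and uac: "AE x in lebesgue. x \<in> \<Omega> \<longrightarrow> abs_cont_on 0 T (u x)"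
    and ui: "AE x in lebesgue. x \<in> \<Omega> \<longrightarrow> u x 0 = u0 x"
    and uz: "\<And>x t. x \<notin> \<Omega> \<Longrightarrow> t \<in> {0<..<T} \<Longrightarrow> u x t = 0"
    and uid: "\<And>\<phi>. \<phi> \<in> test_functions s p \<Omega> T \<Longrightarrow> weak_identity \<alpha> s p \<gamma> \<mu> m q \<Omega> T u \<phi>"
    using W unfolding weak_solution_def by blast+
  have "\<phi> \<in> test_functions s p \<Omega> T"
    unfolding \<phi>_def[abs_def]
    by (rule truncation_test_function[OF p \<Omega> uW uz]) (use B in \<open>auto simp: w_def\<close>)
  from weak_identity_absorption[OF uid[OF this] c P]
  have F: "integrable lebesgue F" "integral\<^sup>L lebesgue F \<le> 0"
    using space_integrand_truncation_nonneg unfolding F_def[abs_def] \<phi>_def[abs_def] by blast+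
  have sec: "F (x, t) = indicator \<Omega> x * (indicator {0<..<T} t
      * ((caputo \<alpha> (u x) t + c * (\<bar>u x t\<bar> powr (r - 1) * u x t)) * max 0 (u x t - w t)))" for x t
    by (simp add: F_def time_integrand_def power_integrand_def \<phi>_def indicator_times algebra_simps)
  define I where "I x = (LINT t|lebesgue. F (x, t))" for x
  have key: "AE x in lebesgue. 0 \<le> I x \<and> (I x = 0 \<longrightarrow> x \<in> \<Omega> \<longrightarrow> (\<forall>t\<in>{0..T}. u x t \<le> w t))"
    using lebesgue_Fubini(1)[OF F(1)] uac ui u0 pos
  proof eventually_elim
    case (elim x)
    show ?case
    proof (cases "x \<in> \<Omega>")
      case False
      thus ?thesis by (simp add: I_def sec)
    next
      case True
      define \<Psi> where "\<Psi> t = indicator {0<..<T} t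
        * ((caputo \<alpha> (u x) t + c * (\<bar>u x t\<bar> powr (r - 1) * u x t))
          * max 0 (u x t - B * (L + t) powr (- (\<alpha> / r))))" for t
      have e: "(\<lambda>t. F (x, t)) = \<Psi>" using True by (simp add: sec \<Psi>_def[abs_def] w_def)
      have \<Psi>: "integrable lebesgue \<Psi>" using elim(1) unfolding e .
      have y: "abs_cont_on 0 T (u x)" "0 \<le> u x 0" "u x 0 \<le> B * (L + 0) powr (- (\<alpha> / r))"
        "\<And>t. 0 < t \<Longrightarrow> 0 < u x t"
        using elim True by auto
      note C = trajectory_comparison[OF \<alpha> r c T B L barrier y, folded \<Psi>_def, OF _ _ \<Psi>]
      show ?thesis unfolding I_def e w_def using C by blast
    qed
  qed
  have Ii: "integrable lebesgue I" and "integral\<^sup>L lebesgue I \<le> 0"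
    using lebesgue_Fubini(2,3)[OF F(1)] F(2) by (simp_all add: I_def[abs_def])
  moreover have nn: "AE x in lebesgue. 0 \<le> I x" using key by eventually_elim simp
  ultimately have "integral\<^sup>L lebesgue I = 0"
    using integral_nonneg_AE[OF nn] by simp
  hence "AE x in lebesgue. I x = 0" using integral_nonneg_eq_0_iff_AE[OF Ii nn] by simp
  with key show ?thesis by eventually_elim (simp add: w_def)
qed

section \<open>The uniform decay estimate for all times\<close>

theorem theorem6:
  fixes \<Omega> :: "'a::euclidean_space set" and u0 :: "'a \<Rightarrow> real"
    and \<alpha> s p \<gamma> \<mu> m q r :: real
  assumes "smoothly_bounded_domain \<Omega>"
    and "0 < \<alpha>" "\<alpha> < 1" and "0 < s" "s < 1" and "2 \<le> p"
    and "u0 \<in> Linf_on \<Omega>"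
    and "AE x in lebesgue. x \<in> \<Omega> \<longrightarrow> 0 < u0 x"
    and "(m = q - 1 \<and> q - 1 > 0 \<and> \<gamma> + \<mu> < 0 \<and> (r = m \<or> r = q - 1)) \<or>
         (m > 0 \<and> q > 1 \<and> \<gamma> < 0 \<and> \<mu> = 0 \<and> r = m) \<or>
         (m > 0 \<and> q > 1 \<and> \<gamma> = 0 \<and> \<mu> < 0 \<and> r = q - 1)"
  shows "\<exists>M>0. \<forall>u. positive_global_solution \<alpha> s p \<gamma> \<mu> m q \<Omega> u0 u \<longrightarrow>
           (AE x in lebesgue. x \<in> \<Omega> \<longrightarrow>
              (\<forall>t\<ge>0. 0 < u x t \<and> u x t \<le> M / (1 + t powr (\<alpha> / r))))"
proof -
  obtain c where c: "0 < c" and r: "0 < r"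
    and P: "\<And>(u :: 'a \<Rightarrow> real \<Rightarrow> real) \<phi> z.
      power_integrand \<gamma> (m - 1) u \<phi> z + power_integrand \<mu> (q - 2) u \<phi> z
      = - c * power_integrand 1 (r - 1) u \<phi> z"
    using absorption_coefficient[OF assms(9)] by metis
  obtain A where A: "AE x in lebesgue. x \<in> \<Omega> \<longrightarrow> \<bar>u0 x\<bar> \<le> A"
    using assms(7) by (auto simp: Linf_on_def)
  \<comment> \<open>The barrier depends only on the bound \<open>A\<close> for \<open>u0\<close> and
    the parameters, so \<open>M\<close> can be fixed before the solution.\<close>
  obtain B L where BL: "0 < B" "0 < L" "A \<le> B * L powr (- (\<alpha> / r))"
    and barrier: "\<And>t. 0 \<le> t \<Longrightarrow> \<alpha> / r * B / Gamma (1 - \<alpha>)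
       * (LINT \<tau>:{0..t}|lebesgue. (t - \<tau>) powr (- \<alpha>) * (L + \<tau>) powr (- (\<alpha> / r) - 1))
       \<le> c * (B * (L + t) powr (- (\<alpha> / r))) powr r"
    using exists_fractional_barrier[OF assms(2,3) r c, of A] by blast
  have \<Omega>: "open \<Omega>" using assms(1) by (simp add: smoothly_bounded_domain_def)
  have u0: "AE x in lebesgue. x \<in> \<Omega> \<longrightarrow> 0 \<le> u0 x \<and> u0 x \<le> B * L powr (- (\<alpha> / r))"
    using A assms(8) by eventually_elim (use BL(3) in auto)
  \<comment> \<open>This constant comes from \<open>1 \<le> L powr (- (\<alpha> / r)) * (L + t) powr
    (\<alpha> / r)\<close> added to
    \<open>t powr (\<alpha> / r) \<le> (L + t) powr (\<alpha> / r)\<close>.\<close>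
  define M where "M = B * (L powr (- (\<alpha> / r)) + 1)"
  have M: "0 < M" using BL by (simp add: M_def add_pos_pos)
  have decay: "B * (L + t) powr (- (\<alpha> / r)) \<le> M / (1 + t powr (\<alpha> / r))" if t: "0 \<le> t" for t
  proof -
    have "1 = L powr (- (\<alpha> / r)) * L powr (\<alpha> / r)" using BL by (simp add: powr_minus)
    also have "\<dots> \<le> L powr (- (\<alpha> / r)) * (L + t) powr (\<alpha> / r)"
      using BL t assms(2) r by (intro mult_left_mono powr_mono2) auto
    finally have "1 + t powr (\<alpha> / r)
        \<le> L powr (- (\<alpha> / r)) * (L + t) powr (\<alpha> / r) + (L + t) powr (\<alpha> / r)"
      using BL t assms(2) r by (intro add_mono powr_mono2) auto
    also have "\<dots> = (L powr (- (\<alpha> / r)) + 1) * (L + t) powr (\<alpha> / r)" by (simp add: algebra_simps)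
    finally have "B * (1 + t powr (\<alpha> / r)) \<le> M * (L + t) powr (\<alpha> / r)"
      unfolding M_def using BL(1) by (simp add: mult.assoc)
    moreover have "0 < 1 + t powr (\<alpha> / r)" by (simp add: add_pos_nonneg)
    moreover have "0 < (L + t) powr (\<alpha> / r)" using BL t by simp
    ultimately show ?thesis by (simp add: powr_minus field_simps)
  qed
  have "AE x in lebesgue. x \<in> \<Omega> \<longrightarrow> (\<forall>t\<ge>0. 0 < u x t \<and> u x t \<le> M / (1 + t powr (\<alpha> / r)))"
    if pg: "positive_global_solution \<alpha> s p \<gamma> \<mu> m q \<Omega> u0 u" for u
  proof -
    have W: "weak_solution \<alpha> s p \<gamma> \<mu> m q \<Omega> u0 (real (Suc n)) u" for n
      using pg by (simp add: positive_global_solution_def global_solution_def)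
    have pos: "AE x in lebesgue. x \<in> \<Omega> \<longrightarrow> (\<forall>t>0. 0 < u x t)"
      using pg by (simp add: positive_global_solution_def)
    have ui: "AE x in lebesgue. x \<in> \<Omega> \<longrightarrow> u x 0 = u0 x"
      using W[of 0] by (simp add: weak_solution_def)
    \<comment> \<open>The exceptional null set depends on the time horizon, so countably many
      horizons are used; \<open>Suc n\<close> keeps them positive.\<close>
    have "AE x in lebesgue. \<forall>n. x \<in> \<Omega> \<longrightarrow>
        (\<forall>t\<in>{0..real (Suc n)}. u x t \<le> B * (L + t) powr (- (\<alpha> / r)))"
      unfolding AE_all_countable
    proof
      fix n
      show "AE x in lebesgue. x \<in> \<Omega> \<longrightarrow>
        (\<forall>t\<in>{0..real (Suc n)}. u x t \<le> B * (L + t) powr (- (\<alpha> / r)))"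
        by (rule weak_solution_le_barrier[OF \<Omega> assms(2,3) _ _ c r P BL(1,2) barrier u0 W pos])
          (use assms(6) in auto)
    qed
    thus ?thesis using pos ui assms(8)
    proof eventually_elim
      case (elim x)
      show ?case
      proof (intro impI allI conjI)
        fix t :: real assume x: "x \<in> \<Omega>" and t: "0 \<le> t"
        \<comment> \<open>Positivity of the solution covers \<open>t > 0\<close>; at
          \<open>t = 0\<close> it comes from the initial datum.\<close>
        show "0 < u x t" using elim x t by (cases "t = 0") auto
        obtain n where "t \<le> real n" using real_arch_simple by blast
        hence "t \<in> {0..real (Suc n)}" using t by simp
        hence "u x t \<le> B * (L + t) powr (- (\<alpha> / r))" using elim(1) x by blast
        thus "u x t \<le> M / (1 + t powr (\<alpha> / r))" using decay[OF t] by simp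
      qed
    qed
  qed
  thus ?thesis using M by blast
qed

end
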